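(* There is a pattern subgroup $U_P(q)\leqslant U_{13}(q)$ such that $k(U_P(q))$ is not a polynomial function of $q$. That is, there exists a partial order $P$ on $\{1,\dots,13\}$, with $i\preceq_P j$ implying $i\le j$, such that no polynomial $f$ satisfies $k(U_P(q))=f(q)$ for all prime powers $q$.
   Context: For a finite group $G$, $k(G)$ denotes the number of conjugacy classes of $G$. $U_n(q)$ is the group of upper triangular $n\times n$ matrices over $\mathbb{F}_q$ with ones on the diagonal. Let $P$ be a partial order on $\{1,\dots,n\}$ having the standard order as a linear extension, i.e. $i\preceq_P j$ implies $i\le j$. The pattern algebra is $\mathcal{U}_P(q)=\{X\in M_{n\times n}(\mathbb{F}_q): X_{i,j}=0 \text{ if } i\not\prec_P j\}$, and the pattern group is $U_P(q)=\{1+X: X\in\mathcal{U}_P(q)\}$, a subgroup of $U_n(q)$. *)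

theory Defs
  imports Complex_Main
    "HOL-Computational_Algebra.Polynomial"
    "HOL-Number_Theory.Prime_Powers"
    "HOL-Algebra.Group_Action"
    "HOL-Algebra.Ring"
begin

text \<open>
  An \<open>n \<times> n\<close> matrix over \<open>F\<close> is a function on index pairs in \<open>{1..n} \<times> {1..n}\<close>, extensional
  (that is, \<open>undefined\<close>) outside, so that equal entries mean equal matrices and counting is
  meaningful.
\<close>

definition matrices :: "('a, 'b) ring_scheme \<Rightarrow> nat \<Rightarrow> (nat \<times> nat \<Rightarrow> 'a) set" where
  "matrices F n = ({1..n} \<times> {1..n}) \<rightarrow>\<^sub>E carrier F"

definition mat_one :: "('a, 'b) ring_scheme \<Rightarrow> nat \<Rightarrow> nat \<times> nat \<Rightarrow> 'a" where
  "mat_one F n = (\<lambda>(i, j)\<in>{1..n} \<times> {1..n}. if i = j then \<one>\<^bsub>F\<^esub> else \<zero>\<^bsub>F\<^esub>)"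

definition mat_add ::
    "('a, 'b) ring_scheme \<Rightarrow> nat \<Rightarrow> (nat \<times> nat \<Rightarrow> 'a) \<Rightarrow> (nat \<times> nat \<Rightarrow> 'a) \<Rightarrow> nat \<times> nat \<Rightarrow> 'a" where
  "mat_add F n A B = (\<lambda>(i, j)\<in>{1..n} \<times> {1..n}. A (i, j) \<oplus>\<^bsub>F\<^esub> B (i, j))"

definition mat_mult ::
    "('a, 'b) ring_scheme \<Rightarrow> nat \<Rightarrow> (nat \<times> nat \<Rightarrow> 'a) \<Rightarrow> (nat \<times> nat \<Rightarrow> 'a) \<Rightarrow> nat \<times> nat \<Rightarrow> 'a" where
  "mat_mult F n A B =
     (\<lambda>(i, j)\<in>{1..n} \<times> {1..n}. \<Oplus>\<^bsub>F\<^esub>k\<in>{1..n}. A (i, k) \<otimes>\<^bsub>F\<^esub> B (k, j))"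

definition unitriangular_group ::
    "('a, 'b) ring_scheme \<Rightarrow> nat \<Rightarrow> (nat \<times> nat \<Rightarrow> 'a) monoid" where
  "unitriangular_group F n =
     \<lparr>carrier = {A \<in> matrices F n.
        \<forall>i\<in>{1..n}. A (i, i) = \<one>\<^bsub>F\<^esub> \<and> (\<forall>j\<in>{1..n}. j < i \<longrightarrow> A (i, j) = \<zero>\<^bsub>F\<^esub>)},
      mult = mat_mult F n,
      one = mat_one F n\<rparr>"

text \<open>
  A partial order is given by its reflexive relation: \<open>(i, j) \<in> P\<close> means \<open>i \<preceq>\<^sub>P j\<close>, and
  \<open>i \<prec>\<^sub>P j\<close> is \<open>(i, j) \<in> P \<and> i \<noteq> j\<close>.
\<close>

definition pattern_order :: "nat \<Rightarrow> (nat \<times> nat) set \<Rightarrow> bool" where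
  "pattern_order n P \<longleftrightarrow> partial_order_on {1..n} P \<and> (\<forall>(i, j)\<in>P. i \<le> j)"

definition pattern_algebra ::
    "('a, 'b) ring_scheme \<Rightarrow> nat \<Rightarrow> (nat \<times> nat) set \<Rightarrow> (nat \<times> nat \<Rightarrow> 'a) set" where
  "pattern_algebra F n P =
     {X \<in> matrices F n. \<forall>i\<in>{1..n}. \<forall>j\<in>{1..n}.
        \<not> ((i, j) \<in> P \<and> i \<noteq> j) \<longrightarrow> X (i, j) = \<zero>\<^bsub>F\<^esub>}"

definition pattern_group ::
    "('a, 'b) ring_scheme \<Rightarrow> nat \<Rightarrow> (nat \<times> nat) set \<Rightarrow> (nat \<times> nat \<Rightarrow> 'a) monoid" where
  "pattern_group F n P =
     (unitriangular_group F n)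
       \<lparr>carrier := {mat_add F n (mat_one F n) X |X. X \<in> pattern_algebra F n P}\<rparr>"

definition conjugacy_classes :: "('a, 'b) monoid_scheme \<Rightarrow> 'a set set" where
  "conjugacy_classes G =
     orbits G (carrier G) (\<lambda>g. \<lambda>h\<in>carrier G. g \<otimes>\<^bsub>G\<^esub> h \<otimes>\<^bsub>G\<^esub> inv\<^bsub>G\<^esub> g)"

definition class_number :: "('a, 'b) monoid_scheme \<Rightarrow> nat" where
  "class_number G = card (conjugacy_classes G)"

end

theory Submission
  imports Defs "HOL-Number_Theory.Residues" "HOL-Algebra.QuotRing"
begin

text \<open>
  Three rows, six faces and four columns form the three layers of the poset. The complete
  bipartite graph between rows and columns quadrangulates the real projective plane with six
  faces (the quotient of the rhombic dodecahedron by the antipodal map), and each middle node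
  lies below the two columns and above the two rows of its face.

  Counting conjugacy classes amounts to counting commuting pairs. For two elements of the group to
  commute, at every edge the contributions of the two faces at that edge must agree; summing over
  the common values \<open>w\<close> gives a sum over all \<open>3 \<times> 4\<close> matrices \<open>w\<close> of a product over the faces \<open>b\<close>,
  whose factors are polynomials in \<open>q\<close> depending only on the rank of the \<open>2 \<times> 2\<close> submatrix of \<open>w\<close>
  at \<open>b\<close>. Once the support of \<open>w\<close> is fixed, the vanishing of the minors at a proper subset of the faces
  is a system of independent multiplicative conditions, which contributes a polynomial in \<open>q\<close>.
  All six minors of a matrix without zero entries vanish in \<open>(q - 1)\<^sup>6\<close> times as many cases as there
  are solutions of \<open>x\<^sup>2 = 1\<close>, because the first homology of the projective plane is \<open>\<int>/2\<close>.
  So a polynomial for odd primes \<open>q\<close> has the wrong value at \<open>q = 2\<close>.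
\<close>

section \<open>The poset of a quadrangulated projective plane\<close>

text \<open>The three pairs of rows are matched with the three ways to split four columns into two
  pairs; each block of a splitting is one face over the matching pair of rows. For \<open>w\<close>
  without zero entries, a vanishing minor says that \<open>w\<close>, read as a multiplicative
  cochain on the edges directed from rows to columns, has trivial product around that face. The
  boundaries of the six faces are linearly independent over the rationals, so a count of parameters
  predicts \<open>(q - 1) ^ 6\<close> solutions, with 6 = 12 edges - 6 faces = 7 vertices - 1. They
  are dependent modulo 2, however: the boundary map has one elementary divisor 2, and this leaves a
  factor that depends on the parity of \<open>q\<close>. A surface whose first homology is torsion
  free would give no such factor. It remains to exclude that other terms compensate. Every other
  term of the expansion comes from a proper set of faces, where the boundaries stay independent
  modulo every prime. The exceptional term has the coefficient \<open>singular_weight q ^ 6\<close>,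
  which is nonzero at \<open>q = 2\<close>.\<close>

definition rows :: "nat set" where "rows = {1, 2, 3}"
definition faces :: "nat set" where "faces = {4, 5, 6, 7, 8, 9}"
definition cols :: "nat set" where "cols = {10, 11, 12, 13}"

text \<open>The face \<open>b\<close> has the edges from the rows \<open>plus_row b\<close>, \<open>minus_row b\<close> to the columns \<open>left_col b\<close>,
  \<open>right_col b\<close>. Each edge belongs to one face through its plus row and to one through its minus
  row; this makes signs in the commutator equations cancel face by face.\<close>

definition plus_row :: "nat \<Rightarrow> nat" where "plus_row b = [3, 3, 1, 1, 2, 2] ! (b - 4)"
definition minus_row :: "nat \<Rightarrow> nat" where "minus_row b = [2, 2, 3, 3, 1, 1] ! (b - 4)"
definition left_col :: "nat \<Rightarrow> nat" where "left_col b = [10, 12, 10, 11, 10, 11] ! (b - 4)"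
definition right_col :: "nat \<Rightarrow> nat" where "right_col b = [11, 13, 12, 13, 13, 12] ! (b - 4)"

definition face_edges :: "nat \<Rightarrow> (nat \<times> nat) set" where
  "face_edges b = {plus_row b, minus_row b} \<times> {left_col b, right_col b}"

definition edges :: "(nat \<times> nat) set" where "edges = rows \<times> cols"

definition plus_face :: "nat \<times> nat \<Rightarrow> nat" where
  "plus_face e = (THE b. b \<in> faces \<and> e \<in> face_edges b \<and> fst e = plus_row b)"
definition minus_face :: "nat \<times> nat \<Rightarrow> nat" where
  "minus_face e = (THE b. b \<in> faces \<and> e \<in> face_edges b \<and> fst e = minus_row b)"

text \<open>Transitivity forces \<open>edges\<close> to be included: every edge is a chain through
  each of its two faces. Numbering the faces between the rows and the columns makes the usual order
  a linear extension.\<close>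

definition face_order :: "(nat \<times> nat) set" where
  "face_order = Id_on {1..13} \<union> edges \<union>
     (\<Union>b\<in>faces. {plus_row b, minus_row b} \<times> {b} \<union> {b} \<times> {left_col b, right_col b})"

lemma edges_in_order: "e \<in> edges \<Longrightarrow> e \<in> face_order"
  by (simp add: face_order_def)

lemmas face_simps = plus_row_def minus_row_def left_col_def right_col_def

lemma face_columns: "b \<in> faces \<Longrightarrow> plus_row b \<in> rows \<and> minus_row b \<in> rows \<and> left_col b \<in> cols \<and> right_col b \<in> cols \<and>
   plus_row b \<noteq> minus_row b \<and> left_col b \<noteq> right_col b"
  by (auto simp: faces_def face_simps rows_def cols_def)

lemma face_edges_subset: "b \<in> faces \<Longrightarrow> face_edges b \<subseteq> edges"
  using face_columns by (auto simp: face_edges_def edges_def)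

lemma finite_sets [simp]: "finite rows" "finite faces" "finite cols" "finite edges"
  by (auto simp: rows_def faces_def cols_def edges_def)

lemma edge_cases:
  assumes "e \<in> edges"
  obtains "e = (1, 10)" | "e = (1, 11)" | "e = (1, 12)" | "e = (1, 13)"
  | "e = (2, 10)" | "e = (2, 11)" | "e = (2, 12)" | "e = (2, 13)"
  | "e = (3, 10)" | "e = (3, 11)" | "e = (3, 12)" | "e = (3, 13)"
  using assms unfolding edges_def rows_def cols_def by blast

lemma card_faces: "card faces = 6" and card_edges: "card edges = 12"
  by (simp_all add: faces_def edges_def rows_def cols_def card_cartesian_product)

text \<open>The plus row singles out one splitting of the columns, and the column of
  \<open>e\<close> picks the block. Such an assignment exists because each row has even degree: plus
  and minus alternate among the four faces around it.\<close>

lemma ex1_plus_face: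
  assumes "e \<in> edges" shows "\<exists>!b. b \<in> faces \<and> e \<in> face_edges b \<and> fst e = plus_row b"
proof (rule ex_ex1I)
  have "\<exists>b\<in>faces. e \<in> face_edges b \<and> fst e = plus_row b"
    using assms by (elim edge_cases) (simp_all add: faces_def face_edges_def face_simps)
  then show "\<exists>b. b \<in> faces \<and> e \<in> face_edges b \<and> fst e = plus_row b"
    by blast
next
  fix b b'
  assume "b \<in> faces \<and> e \<in> face_edges b \<and> fst e = plus_row b" "b' \<in> faces \<and> e \<in> face_edges b' \<and> fst e = plus_row b'"
  then have "b \<in> faces" "b' \<in> faces" "plus_row b = plus_row b'" "{left_col b, right_col b} \<inter> {left_col b', right_col b'} \<noteq> {}"
    by (auto simp: face_edges_def)
  then show "b = b'"
    unfolding faces_def by (elim insertE emptyE) (simp_all add: face_simps)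
qed

lemma ex1_minus_face:
  assumes "e \<in> edges" shows "\<exists>!b. b \<in> faces \<and> e \<in> face_edges b \<and> fst e = minus_row b"
proof (rule ex_ex1I)
  have "\<exists>b\<in>faces. e \<in> face_edges b \<and> fst e = minus_row b"
    using assms by (elim edge_cases) (simp_all add: faces_def face_edges_def face_simps)
  then show "\<exists>b. b \<in> faces \<and> e \<in> face_edges b \<and> fst e = minus_row b"
    by blast
next
  fix b b'
  assume "b \<in> faces \<and> e \<in> face_edges b \<and> fst e = minus_row b" "b' \<in> faces \<and> e \<in> face_edges b' \<and> fst e = minus_row b'"
  then have "b \<in> faces" "b' \<in> faces" "minus_row b = minus_row b'" "{left_col b, right_col b} \<inter> {left_col b', right_col b'} \<noteq> {}"
    by (auto simp: face_edges_def)
  then show "b = b'"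
    unfolding faces_def by (elim insertE emptyE) (simp_all add: face_simps)
qed

lemma plus_face:
  assumes "e \<in> edges" shows "plus_face e \<in> faces" "e \<in> face_edges (plus_face e)" "fst e = plus_row (plus_face e)"
  using theI'[OF ex1_plus_face[OF assms]] by (auto simp: plus_face_def)
lemma minus_face:
  assumes "e \<in> edges" shows "minus_face e \<in> faces" "e \<in> face_edges (minus_face e)" "fst e = minus_row (minus_face e)"
  using theI'[OF ex1_minus_face[OF assms]] by (auto simp: minus_face_def)
lemma plus_face_eqI: "e \<in> edges \<Longrightarrow> b \<in> faces \<Longrightarrow> e \<in> face_edges b \<Longrightarrow> fst e = plus_row b \<Longrightarrow> plus_face e = b"
  using ex1_plus_face plus_face by blast
lemma minus_face_eqI: "e \<in> edges \<Longrightarrow> b \<in> faces \<Longrightarrow> e \<in> face_edges b \<Longrightarrow> fst e = minus_row b \<Longrightarrow> minus_face e = b"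
  using ex1_minus_face minus_face by blast
lemma plus_face_neq_minus_face: "e \<in> edges \<Longrightarrow> plus_face e \<noteq> minus_face e"
  using plus_face minus_face face_columns by metis

text \<open>The surface is closed: no edge lies on a boundary. The commutator equations and the
  elimination of minors both rest on this.\<close>

lemma face_containing_edge:
  assumes "e \<in> edges" "b \<in> faces"
  shows "e \<in> face_edges b \<longleftrightarrow> b = plus_face e \<or> b = minus_face e"
proof
  assume "e \<in> face_edges b"
  then show "b = plus_face e \<or> b = minus_face e"
    using plus_face_eqI[OF assms] minus_face_eqI[OF assms] by (auto simp: face_edges_def)
qed (use plus_face(2) minus_face(2) assms in blast)

section \<open>Layers, chains and the order axioms\<close>

lemma layers_le: "i \<in> rows \<Longrightarrow> i \<in> {1..13}" "i \<in> faces \<Longrightarrow> i \<in> {1..13}" "i \<in> cols \<Longrightarrow> i \<in> {1..13}"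
  by (auto simp: rows_def faces_def cols_def)

lemma layers_disjoint: "i \<in> rows \<Longrightarrow> i \<notin> faces" "i \<in> rows \<Longrightarrow> i \<notin> cols" "i \<in> faces \<Longrightarrow> i \<notin> cols"
  "i \<in> faces \<Longrightarrow> i \<notin> rows" "i \<in> cols \<Longrightarrow> i \<notin> faces" "i \<in> cols \<Longrightarrow> i \<notin> rows"
  by (auto simp: rows_def faces_def cols_def)

lemma face_order_cases:
  assumes "(i, j) \<in> face_order"
  obtains "i = j" "i \<in> {1..13}" | "(i, j) \<in> edges" "i \<in> rows" "j \<in> cols"
  | "j \<in> faces" "i \<in> {plus_row j, minus_row j}" "i \<in> rows"
  | "i \<in> faces" "j \<in> {left_col i, right_col i}" "j \<in> cols"
proof -
  from assms consider "i = j" "i \<in> {1..13}" | "(i, j) \<in> edges"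
    | b where "b \<in> faces" "(i, j) \<in> {plus_row b, minus_row b} \<times> {b}"
    | b where "b \<in> faces" "(i, j) \<in> {b} \<times> {left_col b, right_col b}"
    unfolding face_order_def Id_on_iff Un_iff UN_iff by blast
  then show thesis
  proof cases
    case 3
    then show thesis using face_columns[of b] that(3) by auto
  next
    case 4
    then show thesis using face_columns[of b] that(4) by auto
  qed (use that in \<open>simp_all add: edges_def\<close>)
qed

text \<open>Strict chains have at most three members, so the pattern algebra has cube zero, and
  products of two of its elements are supported on \<open>edges\<close>.\<close>

lemma strict_chain:
  assumes "(i, k) \<in> face_order" "(k, j) \<in> face_order" "i \<noteq> k" "k \<noteq> j"
  shows "i \<in> rows \<and> k \<in> faces \<and> j \<in> cols \<and> (i, j) \<in> face_edges k"
  using assms(1)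
proof (cases rule: face_order_cases)
  case 2
  with assms(2,4) layers_disjoint(5,6)[of k] show ?thesis
    by (auto elim: face_order_cases)
next
  case 3
  with assms(2,4) layers_disjoint(3,4)[of k] show ?thesis
    by (auto elim!: face_order_cases simp: face_edges_def)
next
  case 4
  with assms(2,4) layers_disjoint(5,6)[of k] show ?thesis
    by (auto elim: face_order_cases)
qed (use assms in auto)

lemma pattern_order_face_order: "pattern_order 13 face_order"
  unfolding pattern_order_def partial_order_on_def preorder_on_def
proof (intro conjI)
  have "i \<in> {1..13} \<and> j \<in> {1..13}" if "(i, j) \<in> face_order" for i j
    using that by (cases rule: face_order_cases) (use layers_le in blast)+
  then show "face_order \<subseteq> {1..13} \<times> {1..13}"
    by (metis mem_Sigma_iff subrelI)
  show "refl_on {1..13} face_order"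
    by (simp add: refl_on_def face_order_def Id_on_iff)
  have le: "i < j" if "(i, j) \<in> face_order" "i \<noteq> j" for i j
  proof -
    have *: "i < j" if "i \<in> rows" "j \<in> faces \<or> j \<in> cols"
      using that by (auto simp: rows_def faces_def cols_def)
    have **: "i < j" if "i \<in> faces" "j \<in> cols"
      using that by (auto simp: faces_def cols_def)
    from that(1) show ?thesis
      by (cases rule: face_order_cases) (use * ** that(2) in auto)
  qed
  then show "\<forall>(i, j)\<in>face_order. i \<le> j"
    by (metis case_prodI2 less_imp_le order_refl)
  show "antisym face_order"
    by (rule antisymI) (metis le less_asym)
  show "trans face_order"
  proof (rule transI)
    fix i k j assume ik: "(i, k) \<in> face_order" and kj: "(k, j) \<in> face_order"
    show "(i, j) \<in> face_order"
    proof (cases "i = k \<or> k = j")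
      case False
      with strict_chain[OF ik kj] show ?thesis
        by (simp add: face_order_def edges_def)
    qed (use ik kj in auto)
  qed
qed

section \<open>The pattern group\<close>

declare atLeastAtMost_iff [simp del]

lemma edgesD:
  assumes "(i, j) \<in> edges"
  shows "i \<in> rows" "j \<in> cols" "i \<in> {1..13}" "j \<in> {1..13}" "i \<noteq> j"
proof -
  show i: "i \<in> rows" and j: "j \<in> cols" using assms by (simp_all add: edges_def)
  show "i \<in> {1..13}" "j \<in> {1..13}" by (fact layers_le(1)[OF i] layers_le(3)[OF j])+
  show "i \<noteq> j" using layers_disjoint(2)[OF i] j by metis
qed

locale finite_field = field F for F (structure) +
  assumes finite_carrier: "finite (carrier F)"

context finite_field
begin

text \<open>Turns the set of sums \<open>1 + X\<close> into a product of sets of entries, so that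
  membership and equality can be checked entry by entry.\<close>

lemma carrier_pattern_group:
  "carrier (pattern_group F n P) = (\<Pi>\<^sub>E e\<in>{1..n} \<times> {1..n}.
     if fst e = snd e then {\<one>} else if e \<in> P then carrier F else {\<zero>})" (is "?L = ?R")
proof
  show "?L \<subseteq> ?R"
    by (auto simp: pattern_group_def pattern_algebra_def matrices_def mat_add_def mat_one_def PiE_iff
        split: if_splits)
  show "?R \<subseteq> ?L"
  proof
    fix M assume M: "M \<in> ?R"
    define X where "X = (\<lambda>(i, j)\<in>{1..n} \<times> {1..n}. if i = j then \<zero> else M (i, j))"
    have M_carrier: "M (i, j) \<in> carrier F" if "i \<in> {1..n}" "j \<in> {1..n}" for i j
      using PiE_mem[OF M, of "(i, j)"] that by (auto split: if_splits)
    have "X \<in> pattern_algebra F n P"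
      using PiE_mem[OF M] M_carrier
      by (fastforce simp: X_def pattern_algebra_def matrices_def PiE_iff split: if_splits)
    moreover have "M = mat_add F n (mat_one F n) X"
    proof
      fix e show "M e = mat_add F n (mat_one F n) X e"
      proof (cases "e \<in> {1..n} \<times> {1..n}")
        case True
        then show ?thesis
          using PiE_mem[OF M True] M_carrier
          by (auto simp: mat_add_def mat_one_def X_def split: if_splits)
      next
        case False
        then show ?thesis
          using PiE_arb[OF M False] by (auto simp: mat_add_def)
      qed
    qed
    ultimately show "M \<in> ?L"
      by (auto simp: pattern_group_def)
  qed
qed

abbreviation face_group :: "(nat \<times> nat \<Rightarrow> 'a) monoid" where
  "face_group \<equiv> pattern_group F 13 face_order"

lemma mult_face_group [simp]: "mult face_group = mat_mult F 13"
  and one_face_group [simp]: "one face_group = mat_one F 13"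
  by (simp_all add: pattern_group_def unitriangular_group_def)

lemma face_group_entry:
  assumes "M \<in> carrier face_group" "i \<in> {1..13}" "j \<in> {1..13}"
  shows "M (i, j) \<in> carrier F" "i = j \<Longrightarrow> M (i, j) = \<one>"
    "i \<noteq> j \<Longrightarrow> (i, j) \<notin> face_order \<Longrightarrow> M (i, j) = \<zero>"
proof -
  have "M (i, j) \<in> (if i = j then {\<one>} else if (i, j) \<in> face_order then carrier F else {\<zero>})"
    using PiE_mem[OF assms(1)[unfolded carrier_pattern_group], of "(i, j)"] assms(2,3) by simp
  then show "M (i, j) \<in> carrier F" "i = j \<Longrightarrow> M (i, j) = \<one>"
    "i \<noteq> j \<Longrightarrow> (i, j) \<notin> face_order \<Longrightarrow> M (i, j) = \<zero>"
    by (auto split: if_splits)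
qed

lemma face_groupI:
  assumes "M \<in> extensional ({1..13} \<times> {1..13})"
    and "\<And>i j. i \<in> {1..13} \<Longrightarrow> j \<in> {1..13} \<Longrightarrow> M (i, j) \<in> carrier F"
    and "\<And>i j. i \<in> {1..13} \<Longrightarrow> j \<in> {1..13} \<Longrightarrow> i = j \<Longrightarrow> M (i, j) = \<one>"
    and "\<And>i j. i \<in> {1..13} \<Longrightarrow> j \<in> {1..13} \<Longrightarrow> i \<noteq> j \<Longrightarrow> (i, j) \<notin> face_order \<Longrightarrow> M (i, j) = \<zero>"
  shows "M \<in> carrier face_group"
proof -
  have "M e \<in> (if fst e = snd e then {\<one>} else if e \<in> face_order then carrier F else {\<zero>})"
    if "e \<in> {1..13} \<times> {1..13}" for e
    using assms(2-4)[of "fst e" "snd e"] that by auto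
  then show ?thesis
    unfolding carrier_pattern_group PiE_iff using assms(1) by blast
qed

lemma face_group_eqI:
  assumes "M \<in> carrier face_group" "N \<in> carrier face_group"
    and "\<And>i j. i \<in> {1..13} \<Longrightarrow> j \<in> {1..13} \<Longrightarrow> i \<noteq> j \<Longrightarrow> M (i, j) = N (i, j)"
  shows "M = N"
proof (rule PiE_ext)
  show "M \<in> PiE ({1..13} \<times> {1..13}) (\<lambda>_. carrier F)" "N \<in> PiE ({1..13} \<times> {1..13}) (\<lambda>_. carrier F)"
    using assms(1,2) face_group_entry(1) unfolding carrier_pattern_group by (auto simp: PiE_iff split: if_splits)
  fix e :: "nat \<times> nat" assume "e \<in> {1..13} \<times> {1..13}"
  then show "M e = N e"
    using assms(3)[of "fst e" "snd e"] face_group_entry(2)[OF assms(1), of "fst e" "snd e"]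
      face_group_entry(2)[OF assms(2), of "fst e" "snd e"] by (cases "fst e = snd e") auto
qed

text \<open>The bilinear part of the product, coming from the paths through the middle layer. It is
  the only source of noncommutativity.\<close>

definition link :: "(nat \<times> nat \<Rightarrow> 'a) \<Rightarrow> (nat \<times> nat \<Rightarrow> 'a) \<Rightarrow> nat \<Rightarrow> nat \<Rightarrow> 'a" where
  "link M N i j = (\<Oplus>k\<in>faces. M (i, k) \<otimes> N (k, j))"

lemma link_closed [simp, intro]:
  assumes "M \<in> carrier face_group" "N \<in> carrier face_group" "i \<in> {1..13}" "j \<in> {1..13}"
  shows "link M N i j \<in> carrier F"
  unfolding link_def using assms layers_le(2) face_group_entry(1) by (intro finsum_closed Pi_I m_closed) blast+

text \<open>Off the diagonal, the summands at \<open>k = i\<close> and \<open>k = j\<close> give the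
  linear part. Any other nonzero summand needs a strict chain through \<open>k\<close>, so
  \<open>k\<close> is a face and \<open>(i, j)\<close> is an edge.\<close>

lemma mult_entry:
  assumes M: "M \<in> carrier face_group" and N: "N \<in> carrier face_group" and i: "i \<in> {1..13}" and j: "j \<in> {1..13}"
  shows "mat_mult F 13 M N (i, j) =
    (if i = j then \<one> else M (i, j) \<oplus> N (i, j) \<oplus> (if (i, j) \<in> edges then link M N i j else \<zero>))"
proof -
  let ?t = "\<lambda>k. M (i, k) \<otimes> N (k, j)"
  have t: "?t k \<in> carrier F" if "k \<in> {1..13}" for k
    using that i j face_group_entry(1)[OF M] face_group_entry(1)[OF N] by simp
  have t_zero: "?t k = \<zero>" if "k \<in> {1..13}" "k \<noteq> i" "k \<noteq> j" "k \<notin> faces \<or> (i, j) \<notin> edges" for k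
  proof (cases "(i, k) \<in> face_order \<and> (k, j) \<in> face_order")
    case True
    with strict_chain[of i k j] that show ?thesis
      by (auto simp: edges_def)
  next
    case False
    then show ?thesis
      using that i j face_group_entry[OF M, of i k] face_group_entry[OF N, of k j] by auto
  qed
  have entry: "mat_mult F 13 M N (i, j) = (\<Oplus>k\<in>{1..13}. ?t k)"
    using i j by (simp add: mat_mult_def)
  show ?thesis
  proof (cases "i = j")
    case True
    have zero: "?t k = \<zero>" if "k \<in> {1..13} - {i}" for k
    proof (rule t_zero)
      show "k \<notin> faces \<or> (i, j) \<notin> edges" using True layers_disjoint(2) by (auto simp: edges_def)
    qed (use that True in auto)
    have "(\<Oplus>k\<in>{1..13}. ?t k) = (\<Oplus>k\<in>{i}. ?t k)"
      by (rule add.finprod_mono_neutral_cong_right) (use i t zero in auto)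
    also have "\<dots> = \<one>"
      using True i j t face_group_entry(2)[OF M, of i i] face_group_entry(2)[OF N, of i i] by simp
    finally show ?thesis using entry True by simp
  next
    case False
    let ?K = "{1..13} - {i, j}"
    have ij: "{1..13} = insert i (insert j ?K)" using i j by auto
    have tj: "?t \<in> insert j ?K \<rightarrow> carrier F" and tK: "?t \<in> ?K \<rightarrow> carrier F"
      using t j by auto
    have "(\<Oplus>k\<in>insert i (insert j ?K). ?t k) = ?t i \<oplus> (\<Oplus>k\<in>insert j ?K. ?t k)"
      by (rule finsum_insert[OF _ _ tj]) (use t i False in auto)
    also have "(\<Oplus>k\<in>insert j ?K. ?t k) = ?t j \<oplus> (\<Oplus>k\<in>?K. ?t k)"
      by (rule finsum_insert[OF _ _ tK]) (use t j in auto)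
    finally have sum_all: "(\<Oplus>k\<in>{1..13}. ?t k) = ?t i \<oplus> (?t j \<oplus> (\<Oplus>k\<in>?K. ?t k))"
      unfolding ij[symmetric] .
    have sum_K: "(\<Oplus>k\<in>?K. ?t k) = (if (i, j) \<in> edges then link M N i j else \<zero>)" (is "_ = ?X")
    proof (cases "(i, j) \<in> edges")
      case True
      then have "i \<notin> faces" "j \<notin> faces" using layers_disjoint(1,5) by (simp_all add: edges_def)
      then have sub: "faces \<subseteq> ?K" using layers_le(2) by blast
      have "?t k = \<zero>" if "k \<in> ?K - faces" for k
        using that t_zero by simp
      moreover have "?t \<in> faces \<rightarrow> carrier F"
        using t layers_le(2) by simp
      ultimately have "(\<Oplus>k\<in>?K. ?t k) = (\<Oplus>k\<in>faces. ?t k)"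
        using tK by (intro add.finprod_mono_neutral_cong_right[OF _ sub]) simp_all
      then show ?thesis using True by (simp add: link_def)
    next
      case False
      have "(\<Oplus>k\<in>?K. ?t k) = (\<Oplus>k\<in>?K. \<zero>)"
        by (rule finsum_cong') (simp_all add: t_zero False)
      then show ?thesis using False by (simp only: finsum_zero if_False)
    qed
    have diag: "M (i, i) = \<one>" "N (j, j) = \<one>" and cl: "M (i, j) \<in> carrier F" "N (i, j) \<in> carrier F"
      using i j M N by (simp_all add: face_group_entry)
    have "?X \<in> carrier F" using M N i j by simp
    then have "N (i, j) \<oplus> (M (i, j) \<oplus> ?X) = M (i, j) \<oplus> N (i, j) \<oplus> ?X"
      by (simp only: a_assoc[OF cl] a_lcomm[OF cl(2) cl(1)])
    then show ?thesis
      using entry sum_all False by (simp only: sum_K diag cl l_one r_one if_False)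
  qed
qed

lemma mult_entry_not_edge:
  assumes "M \<in> carrier face_group" "N \<in> carrier face_group" "i \<in> {1..13}" "j \<in> {1..13}"
    and "i \<noteq> j" "(i, j) \<notin> edges"
  shows "mat_mult F 13 M N (i, j) = M (i, j) \<oplus> N (i, j)"
  using assms face_group_entry(1)[OF assms(1,3,4)] face_group_entry(1)[OF assms(2,3,4)]
  by (simp add: mult_entry)

lemma mult_entry_edge:
  assumes "M \<in> carrier face_group" "N \<in> carrier face_group" "(i, j) \<in> edges"
  shows "mat_mult F 13 M N (i, j) = M (i, j) \<oplus> N (i, j) \<oplus> link M N i j"
proof -
  have "i \<in> {1..13}" "j \<in> {1..13}" "i \<noteq> j"
    using edgesD[OF assms(3)] by auto
  then show ?thesis using assms by (simp add: mult_entry)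
qed

text \<open>Entries between a face and a row or column simply add up in a product, which makes
  \<open>link\<close> biadditive. Associativity at an edge reduces to this.\<close>

lemma link_mult:
  assumes L: "L \<in> carrier face_group" and M: "M \<in> carrier face_group" and N: "N \<in> carrier face_group"
    and i: "i \<in> rows" and j: "j \<in> cols"
  shows "link (mat_mult F 13 L M) N i j = link L N i j \<oplus> link M N i j"
    and "link L (mat_mult F 13 M N) i j = link L M i j \<oplus> link L N i j"
proof -
  have cl: "A (i, k) \<in> carrier F" "A (k, j) \<in> carrier F" if "A \<in> carrier face_group" "k \<in> faces" for A k
    using face_group_entry(1)[OF that(1)] i j layers_le that(2) by blast+
  have e: "mat_mult F 13 A B (i, k) = A (i, k) \<oplus> B (i, k)" "mat_mult F 13 A B (k, j) = A (k, j) \<oplus> B (k, j)"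
    if "A \<in> carrier face_group" "B \<in> carrier face_group" "k \<in> faces" for A B k
  proof -
    note k = that(3)
    have "(i, k) \<notin> edges" "(k, j) \<notin> edges"
      using layers_disjoint(3,4)[OF k] by (simp_all add: edges_def)
    moreover have "i \<noteq> k" "k \<noteq> j"
      using layers_disjoint(3,4)[OF k] i j by metis+
    moreover have "i \<in> {1..13}" "j \<in> {1..13}" "k \<in> {1..13}"
      by (fact layers_le(1)[OF i] layers_le(3)[OF j] layers_le(2)[OF k])+
    ultimately show "mat_mult F 13 A B (i, k) = A (i, k) \<oplus> B (i, k)" "mat_mult F 13 A B (k, j) = A (k, j) \<oplus> B (k, j)"
      using that by (simp_all only: mult_entry_not_edge simp_thms)
  qed
  have "link (mat_mult F 13 L M) N i j = (\<Oplus>k\<in>faces. L (i, k) \<otimes> N (k, j) \<oplus> M (i, k) \<otimes> N (k, j))"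
    unfolding link_def by (rule finsum_cong') (simp_all add: e cl L M N l_distr)
  also have "\<dots> = link L N i j \<oplus> link M N i j"
    unfolding link_def by (rule finsum_addf) (simp_all add: cl L M N)
  finally show "link (mat_mult F 13 L M) N i j = link L N i j \<oplus> link M N i j" .
  have "link L (mat_mult F 13 M N) i j = (\<Oplus>k\<in>faces. L (i, k) \<otimes> M (k, j) \<oplus> L (i, k) \<otimes> N (k, j))"
    unfolding link_def by (rule finsum_cong') (simp_all add: e cl L M N r_distr)
  also have "\<dots> = link L M i j \<oplus> link L N i j"
    unfolding link_def by (rule finsum_addf) (simp_all add: cl L M N)
  finally show "link L (mat_mult F 13 M N) i j = link L M i j \<oplus> link L N i j" .
qed

lemma mult_closed_face_group:
  assumes "M \<in> carrier face_group" "N \<in> carrier face_group"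
  shows "mat_mult F 13 M N \<in> carrier face_group"
proof (rule face_groupI)
  show "mat_mult F 13 M N \<in> extensional ({1..13} \<times> {1..13})"
    by (simp add: mat_mult_def)
qed (use assms assms[THEN face_group_entry(1)] assms[THEN face_group_entry(3)] edges_in_order in \<open>auto simp: mult_entry\<close>)

lemma one_in_face_group: "mat_one F 13 \<in> carrier face_group"
  by (rule face_groupI) (auto simp: mat_one_def)

lemma link_one:
  assumes M: "M \<in> carrier face_group" and i: "i \<in> rows" and j: "j \<in> cols"
  shows "link (mat_one F 13) M i j = \<zero>"
proof -
  have "mat_one F 13 (i, k) = \<zero>" "M (k, j) \<in> carrier F" if "k \<in> faces" for k
    using layers_le(1)[OF i] layers_le(3)[OF j] layers_le(2)[OF that] layers_disjoint(1)[OF i] that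
      face_group_entry(1)[OF M] by (auto simp: mat_one_def)
  then have "link (mat_one F 13) M i j = (\<Oplus>k\<in>faces. \<zero>)"
    unfolding link_def by (intro finsum_cong') simp_all
  then show ?thesis by (simp add: finsum_zero)
qed

lemma group_face_group: "group face_group"
proof (rule groupI; (unfold mult_face_group one_face_group)?)
  fix L M N assume L: "L \<in> carrier face_group" and M: "M \<in> carrier face_group" and N: "N \<in> carrier face_group"
  note LM = mult_closed_face_group[OF L M] and MN = mult_closed_face_group[OF M N]
  show "mat_mult F 13 (mat_mult F 13 L M) N = mat_mult F 13 L (mat_mult F 13 M N)"
  proof (rule face_group_eqI)
    fix i j assume ij: "i \<in> {1..13::nat}" "j \<in> {1..13::nat}" "i \<noteq> j"
    note cl = face_group_entry(1)[OF L ij(1,2)] face_group_entry(1)[OF M ij(1,2)] face_group_entry(1)[OF N ij(1,2)]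
      link_closed[OF L M ij(1,2)] link_closed[OF L N ij(1,2)] link_closed[OF M N ij(1,2)]
    show "mat_mult F 13 (mat_mult F 13 L M) N (i, j) = mat_mult F 13 L (mat_mult F 13 M N) (i, j)"
    proof (cases "(i, j) \<in> edges")
      case True
      have "mat_mult F 13 (mat_mult F 13 L M) N (i, j)
          = L (i, j) \<oplus> M (i, j) \<oplus> link L M i j \<oplus> N (i, j) \<oplus> (link L N i j \<oplus> link M N i j)"
        using edgesD[OF True] True by (simp only: mult_entry_edge[OF LM N] mult_entry_edge[OF L M] link_mult[OF L M N])
      moreover have "mat_mult F 13 L (mat_mult F 13 M N) (i, j)
          = L (i, j) \<oplus> (M (i, j) \<oplus> N (i, j) \<oplus> link M N i j) \<oplus> (link L M i j \<oplus> link L N i j)"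
        using edgesD[OF True] True by (simp only: mult_entry_edge[OF L MN] mult_entry_edge[OF M N] link_mult[OF L M N])
      ultimately show ?thesis using cl by (simp add: a_ac)
    next
      case False
      then show ?thesis
        using ij cl by (simp add: mult_entry_not_edge L M N LM MN a_assoc)
    qed
  qed (use L MN LM N mult_closed_face_group in blast)+
next
  fix M assume M: "M \<in> carrier face_group"
  note I = one_in_face_group
  show "mat_mult F 13 (mat_one F 13) M = M"
  proof (rule face_group_eqI)
    fix i j assume ij: "i \<in> {1..13::nat}" "j \<in> {1..13::nat}" "i \<noteq> j"
    have one: "mat_one F 13 (i, j) = \<zero>" using ij by (simp add: mat_one_def)
    have cl: "M (i, j) \<in> carrier F" by (rule face_group_entry(1)[OF M ij(1,2)])
    show "mat_mult F 13 (mat_one F 13) M (i, j) = M (i, j)"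
    proof (cases "(i, j) \<in> edges")
      case True
      with edgesD[OF True] show ?thesis
        by (simp add: mult_entry_edge[OF I M] link_one[OF M] one cl)
    next
      case False
      then show ?thesis using ij by (simp add: mult_entry_not_edge[OF I M] one cl)
    qed
  qed (use M I mult_closed_face_group in blast)+
  \<comment> \<open>With \<open>M = 1 + X\<close> and \<open>X ^ 3 = 0\<close> the inverse is
    \<open>1 - X + X ^ 2\<close>; the entries of \<open>X ^ 2\<close> are \<open>link M M\<close> at
    edges and zero elsewhere.\<close>
  define N where "N = (\<lambda>(i, j)\<in>{1..13} \<times> {1..13}. if i = j then \<one> else
      (if (i, j) \<in> edges then link M M i j \<ominus> M (i, j) else \<ominus> M (i, j)))"
  have N_entry: "N (i, j) = (if i = j then \<one> else
      (if (i, j) \<in> edges then link M M i j \<ominus> M (i, j) else \<ominus> M (i, j)))"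
    if "i \<in> {1..13}" "j \<in> {1..13}" for i j
    using that unfolding N_def by simp
  have N: "N \<in> carrier face_group"
  proof (rule face_groupI)
    fix i j assume ij: "i \<in> {1..13::nat}" "j \<in> {1..13::nat}"
    show "N (i, j) \<in> carrier F"
      using face_group_entry(1)[OF M ij] link_closed[OF M M ij] by (simp add: N_entry[OF ij])
    show "N (i, j) = \<one>" if "i = j" using N_entry[OF ij] that by auto
    show "N (i, j) = \<zero>" if "i \<noteq> j" "(i, j) \<notin> face_order"
      using that face_group_entry(3)[OF M ij that] edges_in_order by (auto simp: N_entry[OF ij])
  qed (simp add: N_def)
  have link_N: "link N M i j = \<ominus> link M M i j" if i: "i \<in> rows" and j: "j \<in> cols" for i j
  proof -
    have ij: "i \<in> {1..13}" "j \<in> {1..13}" using that layers_le by blast+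
    have cl: "M (i, k) \<in> carrier F" "M (k, j) \<in> carrier F" if "k \<in> faces" for k
      using face_group_entry(1)[OF M] ij layers_le(2)[OF that] by blast+
    have N_ik: "N (i, k) = \<ominus> M (i, k)" if "k \<in> faces" for k
      using N_entry[OF ij(1) layers_le(2)[OF that]] that layers_disjoint(1)[OF i] layers_disjoint(3)[OF that]
      by (auto simp: edges_def)
    have "link N M i j = (\<Oplus>k\<in>faces. \<ominus> \<one> \<otimes> (M (i, k) \<otimes> M (k, j)))"
      unfolding link_def by (rule finsum_cong') (simp_all add: N_ik cl l_minus)
    also have "\<dots> = \<ominus> \<one> \<otimes> link M M i j"
      unfolding link_def by (rule finsum_rdistr[symmetric]) (simp_all add: cl)
    finally show ?thesis using link_closed[OF M M ij] by (simp add: l_minus)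
  qed
  have "mat_mult F 13 N M = mat_one F 13"
  proof (rule face_group_eqI)
    fix i j assume ij: "i \<in> {1..13::nat}" "j \<in> {1..13::nat}" "i \<noteq> j"
    have one: "mat_one F 13 (i, j) = \<zero>" using ij by (simp add: mat_one_def)
    have cl: "link M M i j \<in> carrier F" "M (i, j) \<in> carrier F"
      using link_closed[OF M M ij(1,2)] face_group_entry(1)[OF M ij(1,2)] by blast+
    show "mat_mult F 13 N M (i, j) = mat_one F 13 (i, j)"
    proof (cases "(i, j) \<in> edges")
      case True
      have "mat_mult F 13 N M (i, j) = link M M i j \<ominus> M (i, j) \<oplus> M (i, j) \<oplus> \<ominus> link M M i j"
        using edgesD[OF True] ij True
        by (simp only: mult_entry_edge[OF N M] link_N N_entry if_True if_False simp_thms)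
      also have "\<dots> = \<zero>" using cl by algebra
      finally show ?thesis using one by simp
    next
      case False
      then show ?thesis
        using ij cl by (simp add: mult_entry_not_edge[OF N M] N_entry one l_neg)
    qed
  qed (use M N one_in_face_group mult_closed_face_group in blast)+
  then show "\<exists>N\<in>carrier face_group. mat_mult F 13 N M = mat_one F 13"
    using N by (rule bexI)
qed (fact mult_closed_face_group one_in_face_group)+

text \<open>The linear parts of both products agree, so only the bilinear parts remain. They do not
  involve the entries at edges, which are therefore unconstrained in a commuting pair.\<close>

lemma commute_iff_link:
  assumes M: "M \<in> carrier face_group" and N: "N \<in> carrier face_group"
  shows "mat_mult F 13 M N = mat_mult F 13 N M \<longleftrightarrow> (\<forall>(i, j)\<in>edges. link M N i j = link N M i j)"
proof
  assume eq: "mat_mult F 13 M N = mat_mult F 13 N M"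
  show "\<forall>(i, j)\<in>edges. link M N i j = link N M i j"
  proof (clarify)
    fix i j assume e: "(i, j) \<in> edges"
    have ij: "i \<in> {1..13}" "j \<in> {1..13}" using edgesD[OF e] by blast+
    note cl = face_group_entry(1)[OF M ij] face_group_entry(1)[OF N ij] link_closed[OF M N ij] link_closed[OF N M ij]
    from fun_cong[OF eq, of "(i, j)"]
    have "M (i, j) \<oplus> N (i, j) \<oplus> link M N i j = M (i, j) \<oplus> N (i, j) \<oplus> link N M i j"
      using a_comm[OF cl(1,2)] by (simp only: mult_entry_edge[OF M N e] mult_entry_edge[OF N M e])
    then show "link M N i j = link N M i j"
      using cl by simp
  qed
next
  assume link: "\<forall>(i, j)\<in>edges. link M N i j = link N M i j"
  show "mat_mult F 13 M N = mat_mult F 13 N M"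
  proof (rule face_group_eqI)
    fix i j assume ij: "i \<in> {1..13::nat}" "j \<in> {1..13::nat}" "i \<noteq> j"
    note comm = a_comm[OF face_group_entry(1)[OF M ij(1,2)] face_group_entry(1)[OF N ij(1,2)]]
    show "mat_mult F 13 M N (i, j) = mat_mult F 13 N M (i, j)"
    proof (cases "(i, j) \<in> edges")
      case True
      then have "link M N i j = link N M i j" using link by blast
      then show ?thesis
        by (simp only: mult_entry_edge[OF M N True] mult_entry_edge[OF N M True] comm)
    next
      case False
      then show ?thesis
        by (simp only: mult_entry_not_edge[OF M N ij False] mult_entry_not_edge[OF N M ij False] comm)
    qed
  qed (use M N mult_closed_face_group in blast)+
qed

lemma link_eq_two_faces:
  assumes M: "M \<in> carrier face_group" and N: "N \<in> carrier face_group" and e: "(i, j) \<in> edges"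
  shows "link M N i j = M (i, plus_face (i, j)) \<otimes> N (plus_face (i, j), j) \<oplus> M (i, minus_face (i, j)) \<otimes> N (minus_face (i, j), j)"
proof -
  let ?t = "\<lambda>k. M (i, k) \<otimes> N (k, j)"
  let ?K = "{plus_face (i, j), minus_face (i, j)}"
  have ij: "i \<in> rows" "j \<in> cols" "i \<in> {1..13}" "j \<in> {1..13}" using edgesD[OF e] by blast+
  have K: "?K \<subseteq> faces" using plus_face(1)[OF e] minus_face(1)[OF e] by simp
  have cl: "M (i, k) \<in> carrier F" "N (k, j) \<in> carrier F" if "k \<in> faces" for k
    using face_group_entry(1)[OF M] face_group_entry(1)[OF N] ij layers_le(2)[OF that] by blast+
  have "?t k = \<zero>" if k: "k \<in> faces - ?K" for k
  proof -
    have kf: "k \<in> faces" and "(i, j) \<notin> face_edges k" using k face_containing_edge[OF e] by auto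
    moreover have neq: "i \<noteq> k" "k \<noteq> j" using layers_disjoint(3,4)[OF kf] ij by metis+
    ultimately have "(i, k) \<notin> face_order \<or> (k, j) \<notin> face_order"
      using strict_chain[of i k j] by blast
    then show ?thesis
      using face_group_entry(3)[OF M ij(3) layers_le(2)[OF kf] neq(1)]
        face_group_entry(3)[OF N layers_le(2)[OF kf] ij(4) neq(2)] cl[OF kf] by auto
  qed
  then have "link M N i j = (\<Oplus>k\<in>?K. ?t k)"
    unfolding link_def by (intro add.finprod_mono_neutral_cong_right[OF _ K]) (simp_all add: cl)
  also have "\<dots> = ?t (plus_face (i, j)) \<oplus> (\<Oplus>k\<in>{minus_face (i, j)}. ?t k)"
    by (rule finsum_insert) (use plus_face_neq_minus_face[OF e] K cl in auto)
  also have "(\<Oplus>k\<in>{minus_face (i, j)}. ?t k) = ?t (minus_face (i, j))"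
    using K cl by simp
  finally show ?thesis .
qed

end

section \<open>Commuting pairs\<close>

context finite_field
begin

section \<open>Sorting the entries of a pair of group elements by faces\<close>

abbreviation vectors :: "('a \<times> 'a) set" where "vectors \<equiv> carrier F \<times> carrier F"

definition pairing :: "'a \<times> 'a \<Rightarrow> 'a \<times> 'a \<Rightarrow> 'a" where
  "pairing r k = fst r \<otimes> fst k \<oplus> snd r \<otimes> snd k"

text \<open>The tuple \<open>d\<close> lists the vectors at the plus row, the minus row, the left
  column and the right column. The vectors have two coordinates because they combine an entry of
  \<open>M\<close> with one of \<open>N\<close>. Every index other than the plus row is read as the
  minus row, and similarly for columns.\<close>

definition row_of :: "nat \<Rightarrow> ('a \<times> 'a) \<times> ('a \<times> 'a) \<times> ('a \<times> 'a) \<times> ('a \<times> 'a) \<Rightarrow> nat \<Rightarrow> 'a \<times> 'a" where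
  "row_of b d i = (if i = plus_row b then fst d else fst (snd d))"
definition col_of :: "nat \<Rightarrow> ('a \<times> 'a) \<times> ('a \<times> 'a) \<times> ('a \<times> 'a) \<times> ('a \<times> 'a) \<Rightarrow> nat \<Rightarrow> 'a \<times> 'a" where
  "col_of b d j = (if j = left_col b then fst (snd (snd d)) else snd (snd (snd d)))"

text \<open>With the row vectors as the rows of a \<open>2 \<times> 2\<close> matrix
  \<open>A\<close> and the column vectors as the columns of \<open>B\<close>, this says that
  \<open>A B\<close> is the submatrix of \<open>w\<close> at the face.\<close>

definition fits where
  "fits w b d \<longleftrightarrow> (\<forall>(i, j)\<in>face_edges b. pairing (row_of b d i) (col_of b d j) = w (i, j))"

abbreviation face_data where "face_data \<equiv> vectors \<times> vectors \<times> vectors \<times> vectors"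

text \<open>With these signs the commutator equation at an edge says that \<open>pairing\<close> has the same value
  for both faces at that edge.\<close>

definition face_part where
  "face_part M N b = ((M (plus_row b, b), \<ominus> N (plus_row b, b)), (\<ominus> M (minus_row b, b), N (minus_row b, b)),
     (N (b, left_col b), M (b, left_col b)), (N (b, right_col b), M (b, right_col b)))"

text \<open>Each entry between a face and one of its rows or columns belongs to exactly one face, so
  these entries split into six independent packets; the entries at edges are kept apart.\<close>

definition pack where
  "pack = (\<lambda>(M, N). (\<lambda>b\<in>faces. face_part M N b, \<lambda>e\<in>edges. (M e, N e)))"

lemma pairing_closed: "r \<in> vectors \<Longrightarrow> k \<in> vectors \<Longrightarrow> pairing r k \<in> carrier F"
  by (auto simp: pairing_def)

lemma face_nodes:
  assumes "b \<in> faces"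
  shows "plus_row b \<in> {1..13}" "minus_row b \<in> {1..13}" "left_col b \<in> {1..13}" "right_col b \<in> {1..13}" "b \<in> {1..13}"
  using face_columns[OF assms] layers_le(1)[of "plus_row b"] layers_le(1)[of "minus_row b"]
    layers_le(3)[of "left_col b"] layers_le(3)[of "right_col b"] layers_le(2)[OF assms] by simp_all

lemma face_part_closed:
  assumes "M \<in> carrier face_group" "N \<in> carrier face_group" "b \<in> faces"
  shows "face_part M N b \<in> face_data"
  using face_nodes[OF assms(3)] face_group_entry(1)[OF assms(1)] face_group_entry(1)[OF assms(2)]
  by (simp add: face_part_def)

lemma row_col_closed:
  "d \<in> face_data \<Longrightarrow> row_of b d i \<in> vectors" "d \<in> face_data \<Longrightarrow> col_of b d j \<in> vectors"
  by (auto simp: row_of_def col_of_def)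

lemma inj_on_pack: "inj_on pack (carrier face_group \<times> carrier face_group)"
proof (rule inj_onI, clarify)
  fix M N M' N'
  assume G: "M \<in> carrier face_group" "N \<in> carrier face_group" "M' \<in> carrier face_group" "N' \<in> carrier face_group"
    and eq: "pack (M, N) = pack (M', N')"
  have part: "face_part M N b = face_part M' N' b" if "b \<in> faces" for b
    using fun_cong[OF arg_cong[OF eq, of fst], of b] that by (simp add: pack_def)
  have edge: "M e = M' e" "N e = N' e" if "e \<in> edges" for e
    using fun_cong[OF arg_cong[OF eq, of snd], of e] that by (simp_all add: pack_def)
  have *: "M (i, j) = M' (i, j) \<and> N (i, j) = N' (i, j)"
    if ij: "i \<in> {1..13}" "j \<in> {1..13}" "i \<noteq> j" for i j
  proof (cases "(i, j) \<in> face_order")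
    case False
    show ?thesis
      using face_group_entry(3)[OF G(1) ij False] face_group_entry(3)[OF G(2) ij False]
        face_group_entry(3)[OF G(3) ij False] face_group_entry(3)[OF G(4) ij False] by simp
  next
    case True
    note cl = face_group_entry(1)[OF G(1) ij(1,2)] face_group_entry(1)[OF G(2) ij(1,2)]
        face_group_entry(1)[OF G(3) ij(1,2)] face_group_entry(1)[OF G(4) ij(1,2)]
    have neg: "x = y" if "x \<in> carrier F" "y \<in> carrier F" "\<ominus> x = \<ominus> y" for x y
      using that by (metis minus_minus)
    from True show ?thesis
    proof (cases rule: face_order_cases)
      case 1 then show ?thesis using ij(3) by blast
    next
      case 2 then show ?thesis using edge by blast
    next
      case 3
      from part[OF 3(1)] 3(2) neg[OF cl(1,3)] neg[OF cl(2,4)] show ?thesis by (auto simp: face_part_def)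
    next
      case 4
      from part[OF 4(1)] 4(2) show ?thesis by (auto simp: face_part_def)
    qed
  qed
  show "M = M' \<and> N = N'"
    using face_group_eqI[OF G(1,3)] face_group_eqI[OF G(2,4)] * by metis
qed

text \<open>Inverse of \<open>pack\<close>, giving the entries of both matrices at once as a pair.
  The minus signs and \<open>prod.swap\<close> undo those in \<open>face_part\<close>.\<close>

definition unpack where
  "unpack h g = (\<lambda>(i, j).
     if (i, j) \<in> edges then g (i, j)
     else if j \<in> faces \<and> i = plus_row j then (fst (fst (h j)), \<ominus> snd (fst (h j)))
     else if j \<in> faces \<and> i = minus_row j then (\<ominus> fst (fst (snd (h j))), snd (fst (snd (h j))))
     else if i \<in> faces \<and> j = left_col i then prod.swap (fst (snd (snd (h i))))
     else if i \<in> faces \<and> j = right_col i then prod.swap (snd (snd (snd (h i))))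
     else if i = j then (\<one>, \<one>) else (\<zero>, \<zero>))"

lemma unpack_simps:
  assumes h: "h \<in> faces \<rightarrow>\<^sub>E face_data" and g: "g \<in> edges \<rightarrow>\<^sub>E vectors"
  shows "unpack h g (i, j) \<in> vectors"
    and "e \<in> edges \<Longrightarrow> unpack h g e = g e"
    and "b \<in> faces \<Longrightarrow> unpack h g (plus_row b, b) = (fst (fst (h b)), \<ominus> snd (fst (h b)))"
    and "b \<in> faces \<Longrightarrow> unpack h g (minus_row b, b) = (\<ominus> fst (fst (snd (h b))), snd (fst (snd (h b))))"
    and "b \<in> faces \<Longrightarrow> unpack h g (b, left_col b) = prod.swap (fst (snd (snd (h b))))"
    and "b \<in> faces \<Longrightarrow> unpack h g (b, right_col b) = prod.swap (snd (snd (snd (h b))))"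
    and "i = j \<Longrightarrow> unpack h g (i, j) = (\<one>, \<one>)"
    and "i \<noteq> j \<Longrightarrow> (i, j) \<notin> face_order \<Longrightarrow> unpack h g (i, j) = (\<zero>, \<zero>)"
proof -
  have d: "h b \<in> face_data" if "b \<in> faces" for b using PiE_mem[OF h that] .
  have vec: "fst (fst (h b)) \<in> carrier F" "snd (fst (h b)) \<in> carrier F"
    "fst (fst (snd (h b))) \<in> carrier F" "snd (fst (snd (h b))) \<in> carrier F"
    "fst (snd (snd (h b))) \<in> vectors" "snd (snd (snd (h b))) \<in> vectors"  if "b \<in> faces" for b
    using d[OF that] by auto
  have sw: "prod.swap v \<in> vectors" if "v \<in> vectors" for v using that by auto
  show "unpack h g (i, j) \<in> vectors"
    unfolding unpack_def using vec sw PiE_mem[OF g, of "(i, j)"] by (simp del: mem_Sigma_iff) (simp add: vec)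
  show "e \<in> edges \<Longrightarrow> unpack h g e = g e" by (cases e) (simp add: unpack_def)
  have not_edge: "(i, b) \<notin> edges" "(b, i) \<notin> edges" if "b \<in> faces" for b i
    using layers_disjoint(3,4)[OF that] by (simp_all add: edges_def)
  { assume b: "b \<in> faces"
    note cs = face_columns[OF b]
    have nf: "left_col b \<notin> faces" "right_col b \<notin> faces"
      using cs layers_disjoint(5) by blast+
    have ne: "plus_row b \<noteq> minus_row b" "left_col b \<noteq> right_col b" using cs by blast+
    show "unpack h g (plus_row b, b) = (fst (fst (h b)), \<ominus> snd (fst (h b)))"
      "unpack h g (minus_row b, b) = (\<ominus> fst (fst (snd (h b))), snd (fst (snd (h b))))"
      "unpack h g (b, left_col b) = prod.swap (fst (snd (snd (h b))))"
      "unpack h g (b, right_col b) = prod.swap (snd (snd (snd (h b))))"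
      using b nf ne not_edge[OF b] by (simp_all add: unpack_def) }
  { assume ij: "i = j \<or> (i, j) \<notin> face_order"
    have 1: "(i, j) \<notin> edges"
      using ij edges_in_order edgesD(5) by blast
    have 2: "\<not> (j \<in> faces \<and> (i = plus_row j \<or> i = minus_row j))"
    proof
      assume a: "j \<in> faces \<and> (i = plus_row j \<or> i = minus_row j)"
      then have "i \<in> rows" using face_columns by blast
      then have "i \<noteq> j" using a layers_disjoint(1) by metis
      moreover have "(i, j) \<in> face_order" using a by (auto simp: face_order_def)
      ultimately show False using ij by blast
    qed
    have 3: "\<not> (i \<in> faces \<and> (j = left_col i \<or> j = right_col i))"
    proof
      assume a: "i \<in> faces \<and> (j = left_col i \<or> j = right_col i)"
      then have "j \<in> cols" using face_columns by blast
      then have "i \<noteq> j" using a layers_disjoint(3) by metis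
      moreover have "(i, j) \<in> face_order" using a by (auto simp: face_order_def)
      ultimately show False using ij by blast
    qed
    have "unpack h g (i, j) = (if i = j then (\<one>, \<one>) else (\<zero>, \<zero>))"
      using 1 2 3 unfolding unpack_def prod.case conj_disj_distribL de_Morgan_disj
      by (simp only: if_False simp_thms) }
  note * = this
  show "i = j \<Longrightarrow> unpack h g (i, j) = (\<one>, \<one>)"
    using *[OF disjI1] by simp
  show "i \<noteq> j \<Longrightarrow> (i, j) \<notin> face_order \<Longrightarrow> unpack h g (i, j) = (\<zero>, \<zero>)"
    using *[OF disjI2] by simp
qed

lemma bij_betw_pack:
  "bij_betw pack (carrier face_group \<times> carrier face_group)
     ((faces \<rightarrow>\<^sub>E face_data) \<times> (edges \<rightarrow>\<^sub>E vectors))"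
  unfolding bij_betw_def
proof (intro conjI inj_on_pack equalityI subsetI)
  fix x assume "x \<in> pack ` (carrier face_group \<times> carrier face_group)"
  then obtain M N where MN: "M \<in> carrier face_group" "N \<in> carrier face_group" and x: "x = pack (M, N)"
    by blast
  have "(M e, N e) \<in> vectors" if "e \<in> edges" for e
    using that edgesD(3,4)[of "fst e" "snd e"] face_group_entry(1)[OF MN(1), of "fst e" "snd e"] face_group_entry(1)[OF MN(2), of "fst e" "snd e"] by simp
  moreover have "face_part M N b \<in> face_data" if "b \<in> faces" for b
    using face_part_closed[OF MN that] .
  ultimately show "x \<in> (faces \<rightarrow>\<^sub>E face_data) \<times> (edges \<rightarrow>\<^sub>E vectors)"
    unfolding x pack_def prod.case by (simp add: restrict_PiE_iff)
next
  fix x assume "x \<in> (faces \<rightarrow>\<^sub>E face_data) \<times> (edges \<rightarrow>\<^sub>E vectors)"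
  then obtain h g where x: "x = (h, g)" and h: "h \<in> faces \<rightarrow>\<^sub>E face_data" and g: "g \<in> edges \<rightarrow>\<^sub>E vectors"
    by blast
  note u = unpack_simps[OF h g]
  define M where "M = (\<lambda>e\<in>{1..13} \<times> {1..13}. fst (unpack h g e))"
  define N where "N = (\<lambda>e\<in>{1..13} \<times> {1..13}. snd (unpack h g e))"
  have M_entry: "M (i, j) = fst (unpack h g (i, j))" and N_entry: "N (i, j) = snd (unpack h g (i, j))"
    if "i \<in> {1..13}" "j \<in> {1..13}" for i j
    using that by (simp_all add: M_def N_def)
  have "fst (unpack h g (i, j)) \<in> carrier F" "snd (unpack h g (i, j)) \<in> carrier F" for i j
    using u(1)[of i j] by (simp_all only: mem_Times_iff)
  note cl = this
  have M: "M \<in> carrier face_group" and N: "N \<in> carrier face_group"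
    by (rule face_groupI; simp add: M_def N_def u(7,8) cl)+
  have part: "face_part M N b = h b" if b: "b \<in> faces" for b
  proof -
    have "h b \<in> face_data" using PiE_mem[OF h b] .
    then obtain x1 y1 x2 y2 x3 y3 x4 y4 where hb: "h b = ((x1, y1), (x2, y2), (x3, y3), (x4, y4))"
      and xy: "y1 \<in> carrier F" "x2 \<in> carrier F" by auto
    show ?thesis
      using face_nodes[OF b] xy
      by (simp add: face_part_def M_entry N_entry u(3-6)[OF b] hb)
  qed
  have edge: "(M e, N e) = g e" if "e \<in> edges" for e
    using that edgesD(3,4)[of "fst e" "snd e"] M_entry[of "fst e" "snd e"] N_entry[of "fst e" "snd e"] u(2)[OF that] by simp
  have "(\<lambda>b\<in>faces. face_part M N b) = restrict h faces" "(\<lambda>e\<in>edges. (M e, N e)) = restrict g edges"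
    by (rule restrict_ext, erule part edge)+
  then have "(h, g) = pack (M, N)"
    unfolding pack_def prod.case PiE_restrict[OF h] PiE_restrict[OF g] by simp
  then show "x \<in> pack ` (carrier face_group \<times> carrier face_group)"
    unfolding x by (rule image_eqI) (rule SigmaI[OF M N])
qed

text \<open>The witness \<open>w\<close> records the value on which the two faces at an edge agree.
  Once \<open>w\<close> is fixed, the conditions on different faces are independent, so the count
  becomes a product.\<close>

lemma commute_iff_fits:
  assumes M: "M \<in> carrier face_group" and N: "N \<in> carrier face_group"
  shows "mat_mult F 13 M N = mat_mult F 13 N M \<longleftrightarrow>
    (\<exists>w \<in> edges \<rightarrow>\<^sub>E carrier F. \<forall>b\<in>faces. fits w b (face_part M N b))"
proof -
  define val where "val b e = pairing (row_of b (face_part M N b) (fst e)) (col_of b (face_part M N b) (snd e))" for b e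
  have val_closed: "val b e \<in> carrier F" if "b \<in> faces" for b e
    unfolding val_def by (intro pairing_closed row_col_closed face_part_closed M N that)
  have "link M N i j = link N M i j \<longleftrightarrow> val (plus_face (i, j)) (i, j) = val (minus_face (i, j)) (i, j)"
    if e: "(i, j) \<in> edges" for i j
  proof -
    define P where "P = plus_face (i, j)"
    define Q where "Q = minus_face (i, j)"
    have P: "P \<in> faces" "i = plus_row P" "j = left_col P \<or> j = right_col P"
      using plus_face[OF e] by (auto simp: P_def face_edges_def)
    have Q: "Q \<in> faces" "i = minus_row Q" "j = left_col Q \<or> j = right_col Q"
      using minus_face[OF e] by (auto simp: Q_def face_edges_def)
    have ij: "i \<in> {1..13}" "j \<in> {1..13}" using edgesD[OF e] by blast+
    have cl: "A (i, k) \<in> carrier F" "A (k, j) \<in> carrier F" if "A \<in> carrier face_group" "k \<in> faces" for A k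
      using face_group_entry(1)[OF that(1)] ij layers_le(2)[OF that(2)] by blast+
    have vP: "val P (i, j) = M (i, P) \<otimes> N (P, j) \<oplus> \<ominus> N (i, P) \<otimes> M (P, j)"
      using P by (auto simp: val_def row_of_def col_of_def face_part_def pairing_def)
    have "i \<noteq> plus_row Q" using Q face_columns[OF Q(1)] by simp
    then have vQ: "val Q (i, j) = \<ominus> M (i, Q) \<otimes> N (Q, j) \<oplus> N (i, Q) \<otimes> M (Q, j)"
      using Q by (auto simp: val_def row_of_def col_of_def face_part_def pairing_def)
    \<comment> \<open>Regroups the four products at an edge by face instead of by the order of the
      factors \<open>M\<close> and \<open>N\<close>: index 1 belongs to \<open>P\<close>, index 2 to
      \<open>Q\<close>.\<close>
    have move: "x1 \<oplus> x2 = y1 \<oplus> y2 \<longleftrightarrow> x1 \<oplus> \<ominus> y1 = \<ominus> x2 \<oplus> y2"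
      if cl: "x1 \<in> carrier F" "x2 \<in> carrier F" "y1 \<in> carrier F" "y2 \<in> carrier F" for x1 x2 y1 y2
    proof
      assume eq: "x1 \<oplus> x2 = y1 \<oplus> y2"
      have "x1 \<oplus> \<ominus> y1 = x1 \<oplus> x2 \<oplus> (\<ominus> y1 \<oplus> \<ominus> x2)" using cl by algebra
      also have "\<dots> = \<ominus> x2 \<oplus> y2" unfolding eq using cl by algebra
      finally show "x1 \<oplus> \<ominus> y1 = \<ominus> x2 \<oplus> y2" .
    next
      assume eq: "x1 \<oplus> \<ominus> y1 = \<ominus> x2 \<oplus> y2"
      have "x1 \<oplus> x2 = x1 \<oplus> \<ominus> y1 \<oplus> (y1 \<oplus> x2)" using cl by algebra
      also have "\<dots> = y1 \<oplus> y2" unfolding eq using cl by algebra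
      finally show "x1 \<oplus> x2 = y1 \<oplus> y2" .
    qed
    note clP = cl[OF M P(1)] cl[OF N P(1)] and clQ = cl[OF M Q(1)] cl[OF N Q(1)]
    show ?thesis
      unfolding link_eq_two_faces[OF M N e] link_eq_two_faces[OF N M e] P_def[symmetric] Q_def[symmetric] vP vQ
        l_minus[OF clP(3,2)] l_minus[OF clQ(1,4)]
      using clP clQ by (intro move m_closed)
  qed
  then have "mat_mult F 13 M N = mat_mult F 13 N M \<longleftrightarrow> (\<forall>e\<in>edges. val (plus_face e) e = val (minus_face e) e)"
    unfolding commute_iff_link[OF M N] by auto
  also have "\<dots> \<longleftrightarrow> (\<exists>w \<in> edges \<rightarrow>\<^sub>E carrier F. \<forall>b\<in>faces. \<forall>e\<in>face_edges b. val b e = w e)"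
  proof
    assume eq: "\<forall>e\<in>edges. val (plus_face e) e = val (minus_face e) e"
    show "\<exists>w \<in> edges \<rightarrow>\<^sub>E carrier F. \<forall>b\<in>faces. \<forall>e\<in>face_edges b. val b e = w e"
    proof (rule bexI[of _ "\<lambda>e\<in>edges. val (plus_face e) e"], intro ballI)
      fix b e assume b: "b \<in> faces" and "e \<in> face_edges b"
      then have e: "e \<in> edges" and "b = plus_face e \<or> b = minus_face e"
        using face_edges_subset[OF b] face_containing_edge[of e b] by auto
      then show "val b e = (\<lambda>e\<in>edges. val (plus_face e) e) e" using eq by auto
    next
      show "(\<lambda>e\<in>edges. val (plus_face e) e) \<in> edges \<rightarrow>\<^sub>E carrier F"
        using val_closed plus_face(1) by auto
    qed
  next
    assume "\<exists>w \<in> edges \<rightarrow>\<^sub>E carrier F. \<forall>b\<in>faces. \<forall>e\<in>face_edges b. val b e = w e"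
    then show "\<forall>e\<in>edges. val (plus_face e) e = val (minus_face e) e"
      using plus_face(1,2) minus_face(1,2) by metis
  qed
  also have "\<dots> \<longleftrightarrow> (\<exists>w \<in> edges \<rightarrow>\<^sub>E carrier F. \<forall>b\<in>faces. fits w b (face_part M N b))"
    unfolding fits_def val_def by (simp add: case_prod_beta)
  finally show ?thesis .
qed

section \<open>Counting commuting pairs, and Burnside's lemma\<close>

lemma finite_face_data: "finite face_data"
  using finite_carrier by simp

text \<open>The bijection \<open>pack\<close> counts pairs of elements: six faces with eight
  coordinates and twelve edges with two make the exponent 72, and a square root gives 36.\<close>

lemma card_face_group: "card (carrier face_group) = card (carrier F) ^ 36"
proof -
  have "card (carrier face_group) ^ 2 = card ((faces \<rightarrow>\<^sub>E face_data) \<times> (edges \<rightarrow>\<^sub>E vectors))"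
    using bij_betw_same_card[OF bij_betw_pack] by (simp add: card_cartesian_product power2_eq_square)
  also have "\<dots> = (card (carrier F) ^ 36) ^ 2"
    by (simp add: card_cartesian_product card_PiE finite_carrier card_faces card_edges power_mult_distrib
        flip: power_add power_mult power_Suc2)
  finally show ?thesis
    by (rule power2_eq_imp_eq) simp_all
qed

text \<open>Every edge lies in a face, so the face data determine \<open>w\<close> and the sum
  counts each commuting pair once. The exponent 24 comes from the free edge entries of both
  elements.\<close>

lemma card_commuting:
  "card {(M, N) \<in> carrier face_group \<times> carrier face_group. mat_mult F 13 M N = mat_mult F 13 N M}
    = card (carrier F) ^ 24 *
      (\<Sum>w \<in> edges \<rightarrow>\<^sub>E carrier F. \<Prod>b\<in>faces. card {d \<in> face_data. fits w b d})"
proof -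
  let ?G = "carrier face_group \<times> carrier face_group"
  let ?W = "edges \<rightarrow>\<^sub>E carrier F"
  let ?H = "\<lambda>w. \<Pi>\<^sub>E b\<in>faces. {d \<in> face_data. fits w b d}"
  let ?C = "{(M, N) \<in> ?G. mat_mult F 13 M N = mat_mult F 13 N M}"
  have fst_pack: "fst (pack (M, N)) = (\<lambda>b\<in>faces. face_part M N b)" for M N
    by (simp add: pack_def)
  have image: "pack ` ?C = (\<Union>w\<in>?W. ?H w) \<times> (edges \<rightarrow>\<^sub>E vectors)"
  proof (intro equalityI subsetI)
    fix x assume "x \<in> pack ` ?C"
    then obtain M N where MN: "M \<in> carrier face_group" "N \<in> carrier face_group"
      "mat_mult F 13 M N = mat_mult F 13 N M" and x: "x = pack (M, N)" by auto
    then obtain w where w: "w \<in> ?W" "\<forall>b\<in>faces. fits w b (face_part M N b)"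
      using commute_iff_fits by blast
    have "x \<in> (faces \<rightarrow>\<^sub>E face_data) \<times> (edges \<rightarrow>\<^sub>E vectors)"
      unfolding x by (rule bij_betw_apply[OF bij_betw_pack SigmaI[OF MN(1,2)]])
    moreover have "fst x \<in> ?H w"
      unfolding x fst_pack using w face_part_closed[OF MN(1,2)] by (simp add: restrict_PiE_iff)
    ultimately show "x \<in> (\<Union>w\<in>?W. ?H w) \<times> (edges \<rightarrow>\<^sub>E vectors)"
      using w(1) by (auto simp: mem_Times_iff)
  next
    fix x assume "x \<in> (\<Union>w\<in>?W. ?H w) \<times> (edges \<rightarrow>\<^sub>E vectors)"
    then obtain h g w where x: "x = (h, g)" and w: "w \<in> ?W" and h: "h \<in> ?H w" and g: "g \<in> edges \<rightarrow>\<^sub>E vectors"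
      by auto
    have "h \<in> faces \<rightarrow>\<^sub>E face_data" using h by (simp add: PiE_iff)
    then obtain M N where MN: "M \<in> carrier face_group" "N \<in> carrier face_group" and x': "x = pack (M, N)"
      using g bij_betw_imp_surj_on[OF bij_betw_pack] x by (smt (verit) SigmaE SigmaI image_iff)
    have "fits w b (face_part M N b)" if "b \<in> faces" for b
      using PiE_mem[OF h that] that fst_pack[of M N] x x' by (metis (no_types, lifting) fst_conv mem_Collect_eq restrict_apply')
    then have "mat_mult F 13 M N = mat_mult F 13 N M"
      using commute_iff_fits[OF MN] w by blast
    then show "x \<in> pack ` ?C" using MN x' by blast
  qed
  have "inj_on pack ?C"
    by (rule inj_on_subset[OF inj_on_pack]) auto
  then have "card ?C = card (pack ` ?C)"
    by (rule card_image[symmetric])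
  also have "\<dots> = card (\<Union>w\<in>?W. ?H w) * card (edges \<rightarrow>\<^sub>E vectors)"
    by (simp only: image card_cartesian_product)
  also have "card (\<Union>w\<in>?W. ?H w) = (\<Sum>w\<in>?W. card (?H w))"
  proof (rule card_UN_disjoint)
    show "finite ?W" using finite_carrier by (simp add: finite_PiE)
    show "\<forall>w\<in>?W. finite (?H w)" using finite_face_data by (simp add: finite_PiE)
    show "\<forall>w\<in>?W. \<forall>w'\<in>?W. w \<noteq> w' \<longrightarrow> ?H w \<inter> ?H w' = {}"
    proof (intro ballI impI)
      fix w w' assume w: "w \<in> ?W" "w' \<in> ?W" "w \<noteq> w'"
      then obtain e where e: "e \<in> edges" "w e \<noteq> w' e" using PiE_ext by blast
      have "\<not> (fits w b d \<and> fits w' b d)" if "b = plus_face e" for b d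
        using plus_face(2)[OF e(1)] e(2) that unfolding fits_def by fastforce
      then show "?H w \<inter> ?H w' = {}"
        using plus_face(1)[OF e(1)] by (blast dest: PiE_mem)
    qed
  qed
  also have "\<dots> = (\<Sum>w\<in>?W. \<Prod>b\<in>faces. card {d \<in> face_data. fits w b d})"
    by (simp add: card_PiE)
  also have "card (edges \<rightarrow>\<^sub>E vectors) = card (carrier F) ^ 24"
    by (simp add: card_PiE card_cartesian_product card_edges flip: power2_eq_square power_mult)
  finally show ?thesis by (simp add: mult.commute)
qed

text \<open>Burnside's lemma for conjugation: the number of commuting pairs is the class number
  times the group order. From \<open>q ^ 36\<close> on one side and \<open>q ^ 24\<close> on the
  other, \<open>q ^ 12\<close> remains.\<close>

lemma class_number_face_group:
  "class_number face_group * card (carrier F) ^ 12 =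
      (\<Sum>w \<in> edges \<rightarrow>\<^sub>E carrier F. \<Prod>b\<in>faces. card {d \<in> face_data. fits w b d})" (is "_ = ?S")
proof -
  interpret G: group face_group by (rule group_face_group)
  let ?\<phi> = "\<lambda>g. \<lambda>h\<in>carrier face_group. g \<otimes>\<^bsub>face_group\<^esub> h \<otimes>\<^bsub>face_group\<^esub> inv\<^bsub>face_group\<^esub> g"
  have q: "card (carrier F) > 0" using finite_carrier by (auto simp: card_gt_0_iff)
  then have fin: "finite (carrier face_group)"
    using card_face_group by (metis card.infinite less_not_refl zero_less_power)
  have "class_number face_group * card (carrier F) ^ 36 = (\<Sum>g\<in>carrier face_group. card (invariants (carrier face_group) ?\<phi> g))"
    using group_action.burnside[OF G.action_by_conjugation fin fin]
    by (simp only: class_number_def conjugacy_classes_def order_def card_face_group)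
  also have "\<dots> = (\<Sum>g\<in>carrier face_group. card {h \<in> carrier face_group. mat_mult F 13 g h = mat_mult F 13 h g})"
  proof (intro sum.cong refl arg_cong[where f = card])
    fix g assume g: "g \<in> carrier face_group"
    have "g \<otimes>\<^bsub>face_group\<^esub> h \<otimes>\<^bsub>face_group\<^esub> inv\<^bsub>face_group\<^esub> g = h \<longleftrightarrow> g \<otimes>\<^bsub>face_group\<^esub> h = h \<otimes>\<^bsub>face_group\<^esub> g"
      if "h \<in> carrier face_group" for h
      using g that by (metis G.inv_solve_right G.m_closed)
    then show "invariants (carrier face_group) ?\<phi> g = {h \<in> carrier face_group. mat_mult F 13 g h = mat_mult F 13 h g}"
      by (auto simp: invariants_def)
  qed
  also have "\<dots> = card {(g, h) \<in> carrier face_group \<times> carrier face_group. mat_mult F 13 g h = mat_mult F 13 h g}"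
  proof -
    have "{(g, h) \<in> carrier face_group \<times> carrier face_group. mat_mult F 13 g h = mat_mult F 13 h g} =
        (SIGMA g:carrier face_group. {h \<in> carrier face_group. mat_mult F 13 g h = mat_mult F 13 h g})"
      by auto
    then show ?thesis using fin by simp
  qed
  also have "\<dots> = card (carrier F) ^ 24 * ?S" by (rule card_commuting)
  finally have "class_number face_group * card (carrier F) ^ 36 = card (carrier F) ^ 24 * ?S" .
  then have "card (carrier F) ^ 24 * (class_number face_group * card (carrier F) ^ 12) = card (carrier F) ^ 24 * ?S"
    by (simp only: mult.left_commute[of _ "class_number face_group"] power_add[symmetric]) simp
  then show ?thesis
    by (rule mult_left_cancel[THEN iffD1, rotated]) (use q in simp)
qed

end

section \<open>Factorizations of a \<open>2 \<times> 2\<close> matrix\<close>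

context finite_field
begin

section \<open>Linear systems of two equations in two unknowns\<close>

definition scale :: "'a \<Rightarrow> 'a \<times> 'a \<Rightarrow> 'a \<times> 'a" where
  "scale a r = (a \<otimes> fst r, a \<otimes> snd r)"

definition solutions :: "'a \<times> 'a \<Rightarrow> 'a \<times> 'a \<Rightarrow> 'a \<Rightarrow> 'a \<Rightarrow> ('a \<times> 'a) set" where
  "solutions r r' m n = {k \<in> vectors. pairing r k = m \<and> pairing r' k = n}"

lemma nonzero_inverse:
  assumes "x \<in> carrier F" "x \<noteq> \<zero>"
  obtains y where "y \<in> carrier F" "x \<otimes> y = \<one>" "y \<otimes> x = \<one>"
proof -
  have "x \<in> Units F" using assms field_Units by simp
  then show thesis
    by (intro that[of "inv x"] Units_inv_closed Units_l_inv Units_r_inv)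
qed

lemma card_line:
  assumes r: "r \<in> vectors" "r \<noteq> (\<zero>, \<zero>)" and c: "c \<in> carrier F"
  shows "card {k \<in> vectors. pairing r k = c} = card (carrier F)"
proof -
  obtain x y where xy: "r = (x, y)" "x \<in> carrier F" "y \<in> carrier F" using r by auto
  show ?thesis
  proof (cases "y = \<zero>")
    case False
    then obtain i where i: "i \<in> carrier F" "y \<otimes> i = \<one>" "i \<otimes> y = \<one>" using nonzero_inverse xy by blast
    let ?f = "\<lambda>u. (u, i \<otimes> (c \<ominus> x \<otimes> u))"
    have "pairing r (?f u) = c" if "u \<in> carrier F" for u
    proof -
      have "pairing r (?f u) = x \<otimes> u \<oplus> (y \<otimes> i) \<otimes> (c \<ominus> x \<otimes> u)"
        unfolding pairing_def xy(1) fst_conv snd_conv using that xy i(1) c by algebra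
      also have "\<dots> = c" unfolding i(2) using that xy c by algebra
      finally show ?thesis .
    qed
    moreover have "v = i \<otimes> (c \<ominus> x \<otimes> u)"
      if "u \<in> carrier F" "v \<in> carrier F" "pairing r (u, v) = c" for u v
    proof -
      have "i \<otimes> (c \<ominus> x \<otimes> u) = (i \<otimes> y) \<otimes> v"
        unfolding that(3)[symmetric] pairing_def xy(1) fst_conv snd_conv using that(1,2) xy(2,3) i(1) by algebra
      then show ?thesis unfolding i(3) using that(2) by simp
    qed
    ultimately have *: "{k \<in> vectors. pairing r k = c} = ?f ` carrier F"
      using i(1) c xy(2) by auto
    show ?thesis
      unfolding * by (rule card_image) (auto intro: inj_onI)
  next
    case True
    then have "x \<noteq> \<zero>" using r xy by auto
    then obtain i where i: "i \<in> carrier F" "x \<otimes> i = \<one>" "i \<otimes> x = \<one>" using nonzero_inverse xy by blast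
    let ?f = "\<lambda>v. (i \<otimes> (c \<ominus> y \<otimes> v), v)"
    have "pairing r (?f u) = c" if "u \<in> carrier F" for u
    proof -
      have "pairing r (?f u) = y \<otimes> u \<oplus> (x \<otimes> i) \<otimes> (c \<ominus> y \<otimes> u)"
        unfolding pairing_def xy(1) fst_conv snd_conv using that xy i(1) c by algebra
      also have "\<dots> = c" unfolding i(2) using that xy c by algebra
      finally show ?thesis .
    qed
    moreover have "u = i \<otimes> (c \<ominus> y \<otimes> v)"
      if "u \<in> carrier F" "v \<in> carrier F" "pairing r (u, v) = c" for u v
    proof -
      have "i \<otimes> (c \<ominus> y \<otimes> v) = (i \<otimes> x) \<otimes> u"
        unfolding that(3)[symmetric] pairing_def xy(1) fst_conv snd_conv using that(1,2) xy(2,3) i(1) by algebra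
      then show ?thesis unfolding i(3) using that(1) by simp
    qed
    ultimately have *: "{k \<in> vectors. pairing r k = c} = ?f ` carrier F"
      using i(1) c xy(3) by auto
    show ?thesis
      unfolding * by (rule card_image) (auto intro: inj_onI)
  qed
qed

lemma pairing_scale:
  "r \<in> vectors \<Longrightarrow> k \<in> vectors \<Longrightarrow> a \<in> carrier F \<Longrightarrow> pairing (scale a r) k = a \<otimes> pairing r k"
  by (auto simp: pairing_def scale_def r_distr m_assoc)

text \<open>The second equation has \<open>a\<close> times the left side of the first, so it either
  follows from the first or contradicts it.\<close>

lemma card_solutions_parallel:
  assumes "r \<in> vectors" "r \<noteq> (\<zero>, \<zero>)" "a \<in> carrier F" "m \<in> carrier F"
  shows "card (solutions r (scale a r) m n) = (if a \<otimes> m = n then card (carrier F) else 0)"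
proof -
  have "solutions r (scale a r) m n = (if a \<otimes> m = n then {k \<in> vectors. pairing r k = m} else {})"
    using assms by (auto simp: solutions_def pairing_scale)
  then show ?thesis using card_line[OF assms(1,2,4)] by simp
qed

lemma card_solutions_independent:
  assumes r: "r \<in> vectors" "r \<noteq> (\<zero>, \<zero>)" and r': "r' \<in> vectors" "r' \<notin> (\<lambda>a. scale a r) ` carrier F"
    and mn: "m \<in> carrier F" "n \<in> carrier F"
  shows "card (solutions r r' m n) = 1"
proof -
  obtain x y where xy: "r = (x, y)" "x \<in> carrier F" "y \<in> carrier F" using r by auto
  obtain x' y' where xy': "r' = (x', y')" "x' \<in> carrier F" "y' \<in> carrier F" using r' by auto
  note cl = xy(2,3) xy'(2,3) mn
  let ?D = "x \<otimes> y' \<ominus> y \<otimes> x'"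
  have D: "?D \<noteq> \<zero>"
  proof
    assume "?D = \<zero>"
    moreover have "x \<otimes> y' = ?D \<oplus> y \<otimes> x'" using cl by algebra
    ultimately have D0: "x \<otimes> y' = y \<otimes> x'" using cl by simp
    have "\<exists>a\<in>carrier F. x' = a \<otimes> x \<and> y' = a \<otimes> y"
    proof (cases "x = \<zero>")
      case False
      then obtain i where i: "i \<in> carrier F" "x \<otimes> i = \<one>" "i \<otimes> x = \<one>" using nonzero_inverse xy by blast
      have "x' \<otimes> i \<otimes> x = x' \<otimes> (i \<otimes> x)" "x' \<otimes> i \<otimes> y = i \<otimes> (y \<otimes> x')" "i \<otimes> (x \<otimes> y') = (i \<otimes> x) \<otimes> y'"
        using cl i(1) by (simp_all add: m_ac)
      then show ?thesis using i cl D0 by (intro bexI[of _ "x' \<otimes> i"]) simp_all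
    next
      case True
      then have "y \<noteq> \<zero>" using r xy by auto
      then obtain i where i: "i \<in> carrier F" "y \<otimes> i = \<one>" "i \<otimes> y = \<one>" using nonzero_inverse xy by blast
      have "y' \<otimes> i \<otimes> y = y' \<otimes> (i \<otimes> y)" "y' \<otimes> i \<otimes> x = i \<otimes> (x \<otimes> y')" "i \<otimes> (y \<otimes> x') = (i \<otimes> y) \<otimes> x'"
        using cl i(1) by (simp_all add: m_ac)
      then show ?thesis using i cl D0 by (intro bexI[of _ "y' \<otimes> i"]) simp_all
    qed
    then show False using r'(2) by (auto simp: scale_def xy xy')
  qed
  have "?D \<in> carrier F" using cl by simp
  with D obtain i where i: "i \<in> carrier F" "?D \<otimes> i = \<one>" "i \<otimes> ?D = \<one>" using nonzero_inverse by blast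
  \<comment> \<open>Cramer's rule; \<open>i\<close> is the inverse of the determinant
    \<open>?D\<close>.\<close>
  let ?u = "i \<otimes> (m \<otimes> y' \<ominus> y \<otimes> n)" and ?v = "i \<otimes> (x \<otimes> n \<ominus> m \<otimes> x')"
  have "solutions r r' m n = {(?u, ?v)}"
  proof (intro equalityI subsetI)
    fix k assume k: "k \<in> solutions r r' m n"
    then obtain u v where uv: "k = (u, v)" "u \<in> carrier F" "v \<in> carrier F"
      and m: "m = x \<otimes> u \<oplus> y \<otimes> v" and n: "n = x' \<otimes> u \<oplus> y' \<otimes> v"
      by (auto simp: solutions_def pairing_def xy xy')
    have "?u = (i \<otimes> ?D) \<otimes> u" "?v = (i \<otimes> ?D) \<otimes> v"
      unfolding m n using cl(1-4) i(1) uv(2,3) by algebra+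
    then show "k \<in> {(?u, ?v)}" using uv i(3) by simp
  next
    fix k assume "k \<in> {(?u, ?v)}"
    then have k: "k = (?u, ?v)" by simp
    have "x \<otimes> ?u \<oplus> y \<otimes> ?v = (?D \<otimes> i) \<otimes> m" "x' \<otimes> ?u \<oplus> y' \<otimes> ?v = (?D \<otimes> i) \<otimes> n"
      using cl i(1) by algebra+
    then show "k \<in> solutions r r' m n"
      using cl i(1) unfolding i(2) k by (simp add: solutions_def pairing_def xy xy')
  qed
  then show ?thesis by simp
qed

lemma card_solutions_zero_left:
  assumes "r' \<in> vectors" "r' \<noteq> (\<zero>, \<zero>)" "n \<in> carrier F"
  shows "card (solutions (\<zero>, \<zero>) r' m n) = (if m = \<zero> then card (carrier F) else 0)"
proof -
  have "pairing (\<zero>, \<zero>) k = \<zero>" if "k \<in> vectors" for k using that by (auto simp: pairing_def)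
  then have "solutions (\<zero>, \<zero>) r' m n = (if m = \<zero> then {k \<in> vectors. pairing r' k = n} else {})"
    by (auto simp: solutions_def)
  then show ?thesis using card_line[OF assms] by simp
qed

lemma card_solutions_zero:
  "card (solutions (\<zero>, \<zero>) (\<zero>, \<zero>) m n) = (if m = \<zero> \<and> n = \<zero> then card (carrier F) ^ 2 else 0)"
proof -
  have "pairing (\<zero>, \<zero>) k = \<zero>" if "k \<in> vectors" for k using that by (auto simp: pairing_def)
  then have "solutions (\<zero>, \<zero>) (\<zero>, \<zero>) m n = (if m = \<zero> \<and> n = \<zero> then vectors else {})"
    by (auto simp: solutions_def)
  then show ?thesis by (simp add: card_cartesian_product power2_eq_square)
qed

section \<open>The number of factorizations, by rank\<close>

definition factorizations :: "'a \<Rightarrow> 'a \<Rightarrow> 'a \<Rightarrow> 'a \<Rightarrow> (('a \<times> 'a) \<times> ('a \<times> 'a) \<times> ('a \<times> 'a) \<times> ('a \<times> 'a)) set" where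
  "factorizations m1 m2 n1 n2 = {(r, r', k1, k2) \<in> face_data.
     pairing r k1 = m1 \<and> pairing r k2 = m2 \<and> pairing r' k1 = n1 \<and> pairing r' k2 = n2}"

text \<open>For nonzero \<open>r\<close> and \<open>r' = scale a r\<close>, the systems for both
  columns are solvable exactly when \<open>a\<close> lies in this set.\<close>

definition ratios :: "'a \<Rightarrow> 'a \<Rightarrow> 'a \<Rightarrow> 'a \<Rightarrow> 'a set" where
  "ratios m1 m2 n1 n2 = {a \<in> carrier F. a \<otimes> m1 = n1 \<and> a \<otimes> m2 = n2}"

text \<open>The rows \<open>r\<close>, \<open>r'\<close> of the left factor are chosen first. For
  \<open>r\<close> zero both \<open>m1\<close> and \<open>m2\<close> must vanish. For each of the
  \<open>q\<^sup>2 - 1\<close> nonzero \<open>r\<close>, the \<open>q\<^sup>2 - q\<close> vectors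
  \<open>r'\<close> off its line determine both columns; on the line \<open>r' = scale a r\<close>,
  each \<open>a\<close> in \<open>ratios\<close> leaves \<open>q\<close> choices for each column and
  every other \<open>a\<close> leaves none.\<close>

lemma card_factorizations:
  fixes q :: int
  assumes cl: "m1 \<in> carrier F" "m2 \<in> carrier F" "n1 \<in> carrier F" "n2 \<in> carrier F"
  defines "q \<equiv> int (card (carrier F))"
  shows "int (card (factorizations m1 m2 n1 n2)) =
    (if m1 = \<zero> \<and> m2 = \<zero> then (q\<^sup>2 - 1) * q\<^sup>2 + (if n1 = \<zero> \<and> n2 = \<zero> then q ^ 4 else 0) else 0)
    + (q\<^sup>2 - 1) * (q\<^sup>2 - q + q\<^sup>2 * int (card (ratios m1 m2 n1 n2)))"
proof -
  let ?S = "\<lambda>r r'. solutions r r' m1 n1 \<times> solutions r r' m2 n2"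
  let ?s = "\<lambda>r r'. int (card (solutions r r' m1 n1)) * int (card (solutions r r' m2 n2))"
  let ?z = "(\<zero>, \<zero>)"
  have fin: "finite vectors" "finite (solutions r r' m n)" for r r' m n
    using finite_carrier by (auto simp: solutions_def)
  have card_V: "int (card vectors) = q\<^sup>2"
    by (simp add: q_def card_cartesian_product power2_eq_square)
  have z: "?z \<in> vectors" by simp
  have card_V0: "int (card (vectors - {?z})) = q\<^sup>2 - 1"
    using card_V card_Diff_singleton[OF z] card_gt_0_iff[of vectors] fin(1) z by (auto simp: of_nat_diff Suc_le_eq)
  have "factorizations m1 m2 n1 n2 = (\<lambda>(r, r', k). (r, r', k)) ` (SIGMA r:vectors. SIGMA r':vectors. ?S r r')"
    by (auto simp: factorizations_def solutions_def image_iff)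
  then have "factorizations m1 m2 n1 n2 = (SIGMA r:vectors. SIGMA r':vectors. ?S r r')" by simp
  then have "int (card (factorizations m1 m2 n1 n2)) = (\<Sum>r\<in>vectors. \<Sum>r'\<in>vectors. ?s r r')"
    using fin by (simp add: card_SigmaI card_cartesian_product)
  also have "\<dots> = (\<Sum>r'\<in>vectors. ?s ?z r') + (\<Sum>r\<in>vectors - {?z}. \<Sum>r'\<in>vectors. ?s r r')"
    by (rule sum.remove[OF fin(1) z])
  also have "(\<Sum>r'\<in>vectors. ?s ?z r') = ?s ?z ?z + (\<Sum>r'\<in>vectors - {?z}. ?s ?z r')"
    by (rule sum.remove[OF fin(1) z])
  also have "?s ?z ?z = (if m1 = \<zero> \<and> m2 = \<zero> \<and> n1 = \<zero> \<and> n2 = \<zero> then q ^ 4 else 0)"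
    by (simp add: card_solutions_zero q_def flip: power_add)
  also have "(\<Sum>r'\<in>vectors - {?z}. ?s ?z r') = (\<Sum>r'\<in>vectors - {?z}. if m1 = \<zero> \<and> m2 = \<zero> then q\<^sup>2 else 0)"
    using cl by (intro sum.cong refl) (auto simp: card_solutions_zero_left q_def power2_eq_square)
  also have "\<dots> = (if m1 = \<zero> \<and> m2 = \<zero> then (q\<^sup>2 - 1) * q\<^sup>2 else 0)"
    using card_V0 by simp
  also have "(\<Sum>r\<in>vectors - {?z}. \<Sum>r'\<in>vectors. ?s r r') = (\<Sum>r\<in>vectors - {?z}. q\<^sup>2 - q + q\<^sup>2 * int (card (ratios m1 m2 n1 n2)))"
  proof (rule sum.cong[OF refl])
    fix r assume "r \<in> vectors - {?z}"
    then have r: "r \<in> vectors" "r \<noteq> ?z" by auto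
    let ?L = "(\<lambda>a. scale a r) ` carrier F"
    have L: "?L \<subseteq> vectors" using r by (auto simp: scale_def)
    have inj: "inj_on (\<lambda>a. scale a r) (carrier F)"
    proof (rule inj_onI)
      fix a b assume ab: "a \<in> carrier F" "b \<in> carrier F" "scale a r = scale b r"
      obtain x y where "r = (x, y)" "x \<in> carrier F" "y \<in> carrier F" "x \<noteq> \<zero> \<or> y \<noteq> \<zero>" using r by auto
      with ab show "a = b" by (auto simp: scale_def m_rcancel)
    qed
    have "(\<Sum>r'\<in>vectors. ?s r r') = (\<Sum>r'\<in>vectors - ?L. ?s r r') + (\<Sum>r'\<in>?L. ?s r r')"
      by (rule sum.subset_diff[OF L fin(1)])
    also have "(\<Sum>r'\<in>vectors - ?L. ?s r r') = (\<Sum>r'\<in>vectors - ?L. 1)"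
      using cl r card_solutions_independent by (intro sum.cong refl) simp
    also have "\<dots> = q\<^sup>2 - q"
      using card_V card_Diff_subset[OF finite_subset[OF L fin(1)] L] card_image[OF inj] card_mono[OF fin(1) L]
      by (simp add: q_def of_nat_diff)
    also have "(\<Sum>r'\<in>?L. ?s r r') = (\<Sum>a\<in>carrier F. ?s r (scale a r))"
      by (rule sum.reindex[OF inj, unfolded comp_def])
    also have "\<dots> = (\<Sum>a\<in>carrier F. if a \<in> ratios m1 m2 n1 n2 then q\<^sup>2 else 0)"
      using cl r by (intro sum.cong refl) (auto simp: card_solutions_parallel q_def power2_eq_square ratios_def)
    also have "\<dots> = (\<Sum>a\<in>ratios m1 m2 n1 n2. q\<^sup>2)"
      using finite_carrier by (intro sum.mono_neutral_cong_right) (auto simp: ratios_def)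
    finally show "(\<Sum>r'\<in>vectors. ?s r r') = q\<^sup>2 - q + q\<^sup>2 * int (card (ratios m1 m2 n1 n2))" by simp
  qed
  also have "(\<Sum>r\<in>vectors - {?z}. q\<^sup>2 - q + q\<^sup>2 * int (card (ratios m1 m2 n1 n2))) = (q\<^sup>2 - 1) * (q\<^sup>2 - q + q\<^sup>2 * int (card (ratios m1 m2 n1 n2)))"
    by (simp only: sum_constant card_V0)
  finally show ?thesis
    by simp
qed

lemma card_ratios:
  assumes cl: "m1 \<in> carrier F" "m2 \<in> carrier F" "n1 \<in> carrier F" "n2 \<in> carrier F"
  shows "card (ratios m1 m2 n1 n2) =
    (if m1 = \<zero> \<and> m2 = \<zero> then (if n1 = \<zero> \<and> n2 = \<zero> then card (carrier F) else 0)
     else if m1 \<otimes> n2 = m2 \<otimes> n1 then 1 else 0)"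
proof (cases "m1 = \<zero> \<and> m2 = \<zero>")
  case True
  then have "ratios m1 m2 n1 n2 = (if n1 = \<zero> \<and> n2 = \<zero> then carrier F else {})"
    by (auto simp: ratios_def)
  then show ?thesis using True by simp
next
  case False
  have *: "card (ratios m1 m2 n1 n2) = (if m1 \<otimes> n2 = m2 \<otimes> n1 then 1 else 0)"
    if cl: "m1 \<in> carrier F" "m2 \<in> carrier F" "n1 \<in> carrier F" "n2 \<in> carrier F" and "m1 \<noteq> \<zero>" for m1 m2 n1 n2
  proof -
    obtain i where i: "i \<in> carrier F" "m1 \<otimes> i = \<one>" "i \<otimes> m1 = \<one>" using nonzero_inverse \<open>m1 \<noteq> \<zero>\<close> cl(1) by blast
    have a_eq: "a = n1 \<otimes> i" if "a \<in> carrier F" "a \<otimes> m1 = n1" for a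
    proof -
      have "n1 \<otimes> i = a \<otimes> (m1 \<otimes> i)" unfolding that(2)[symmetric] by (rule m_assoc[OF that(1) cl(1) i(1)])
      then show ?thesis using that(1) by (simp only: i(2) r_one)
    qed
    have n1: "n1 \<otimes> i \<otimes> m1 = n1" using i cl by (simp add: m_assoc)
    have iff: "n1 \<otimes> i \<otimes> m2 = n2 \<longleftrightarrow> m1 \<otimes> n2 = m2 \<otimes> n1"
    proof
      assume "n1 \<otimes> i \<otimes> m2 = n2"
      then have "m1 \<otimes> n2 = m1 \<otimes> (n1 \<otimes> i \<otimes> m2)" by simp
      also have "\<dots> = (m1 \<otimes> i) \<otimes> (m2 \<otimes> n1)" using cl i(1) by (simp add: m_ac)
      finally have "m1 \<otimes> n2 = (m1 \<otimes> i) \<otimes> (m2 \<otimes> n1)" .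
      then show "m1 \<otimes> n2 = m2 \<otimes> n1" using i cl by simp
    next
      assume e: "m1 \<otimes> n2 = m2 \<otimes> n1"
      have "n1 \<otimes> i \<otimes> m2 = i \<otimes> (m2 \<otimes> n1)" using cl i(1) by (simp add: m_ac)
      also have "\<dots> = (i \<otimes> m1) \<otimes> n2" unfolding e[symmetric] using cl i(1) by (simp add: m_ac)
      finally show "n1 \<otimes> i \<otimes> m2 = n2" using i cl by simp
    qed
    have closed: "n1 \<otimes> i \<in> carrier F" using cl(3) i(1) by simp
    have "ratios m1 m2 n1 n2 = {a. a = n1 \<otimes> i \<and> m1 \<otimes> n2 = m2 \<otimes> n1}"
      unfolding iff[symmetric]
    proof (intro equalityI subsetI)
      fix a assume "a \<in> ratios m1 m2 n1 n2"
      then have a: "a \<in> carrier F" "a \<otimes> m1 = n1" "a \<otimes> m2 = n2" by (simp_all add: ratios_def)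
      show "a \<in> {a. a = n1 \<otimes> i \<and> n1 \<otimes> i \<otimes> m2 = n2}"
        using a(3) unfolding a_eq[OF a(1,2)] by simp
    next
      fix a assume "a \<in> {a. a = n1 \<otimes> i \<and> n1 \<otimes> i \<otimes> m2 = n2}"
      then show "a \<in> ratios m1 m2 n1 n2" using n1 closed by (simp add: ratios_def)
    qed
    then show ?thesis by (cases "m1 \<otimes> n2 = m2 \<otimes> n1") simp_all
  qed
  show ?thesis
  proof (cases "m1 = \<zero>")
    case False
    then show ?thesis using *[OF cl] by simp
  next
    case True
    then have "m2 \<noteq> \<zero>" using \<open>\<not> (m1 = \<zero> \<and> m2 = \<zero>)\<close> by blast
    moreover have "ratios m1 m2 n1 n2 = ratios m2 m1 n2 n1" by (auto simp: ratios_def)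
    ultimately show ?thesis
      using *[OF cl(2,1,4,3)] eq_commute[of "m2 \<otimes> n1" "m1 \<otimes> n2"] by simp
  qed
qed

definition minor_vanishes :: "(nat \<times> nat \<Rightarrow> 'a) \<Rightarrow> nat \<Rightarrow> bool" where
  "minor_vanishes w b \<longleftrightarrow>
     w (plus_row b, left_col b) \<otimes> w (minus_row b, right_col b) = w (plus_row b, right_col b) \<otimes> w (minus_row b, left_col b)"

text \<open>The first summand is the order of \<open>GL(2, q)\<close>: an invertible left factor
  determines the right one. For a submatrix of rank one there are also \<open>q\<^sup>2 - 1\<close>
  left factors of rank one with the correct column space, each with \<open>q\<^sup>2\<close> right
  factors. A zero submatrix has a vanishing minor as well, and the last summand is what is then
  still missing.\<close>

lemma card_fits:
  fixes q :: int
  assumes w: "w \<in> edges \<rightarrow>\<^sub>E carrier F" and b: "b \<in> faces"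
  defines "q \<equiv> int (card (carrier F))"
  shows "int (card {d \<in> face_data. fits w b d}) = (q\<^sup>2 - 1) * (q\<^sup>2 - q)
     + (if minor_vanishes w b then (q\<^sup>2 - 1) * q\<^sup>2 else 0)
     + (if \<forall>e\<in>face_edges b. w e = \<zero> then q ^ 5 + q ^ 4 - q ^ 3 else 0)"
proof -
  let ?m1 = "w (plus_row b, left_col b)" and ?m2 = "w (plus_row b, right_col b)"
  let ?n1 = "w (minus_row b, left_col b)" and ?n2 = "w (minus_row b, right_col b)"
  have "face_edges b \<subseteq> edges" by (rule face_edges_subset[OF b])
  then have cl: "?m1 \<in> carrier F" "?m2 \<in> carrier F" "?n1 \<in> carrier F" "?n2 \<in> carrier F"
    using PiE_mem[OF w] by (auto simp: face_edges_def)
  have ne: "plus_row b \<noteq> minus_row b" "left_col b \<noteq> right_col b"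
    using face_columns[OF b] by auto
  have "{d \<in> face_data. fits w b d} = factorizations ?m1 ?m2 ?n1 ?n2"
    using ne by (auto simp: fits_def factorizations_def face_edges_def row_of_def col_of_def)
  then have "int (card {d \<in> face_data. fits w b d}) =
    (if ?m1 = \<zero> \<and> ?m2 = \<zero> then (q\<^sup>2 - 1) * q\<^sup>2 + (if ?n1 = \<zero> \<and> ?n2 = \<zero> then q ^ 4 else 0) else 0)
    + (q\<^sup>2 - 1) * (q\<^sup>2 - q + q\<^sup>2 * int (card (ratios ?m1 ?m2 ?n1 ?n2)))"
    unfolding q_def by (simp only: card_factorizations[OF cl])
  also have "\<dots> = (q\<^sup>2 - 1) * (q\<^sup>2 - q)
     + (if minor_vanishes w b then (q\<^sup>2 - 1) * q\<^sup>2 else 0)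
     + (if ?m1 = \<zero> \<and> ?m2 = \<zero> \<and> ?n1 = \<zero> \<and> ?n2 = \<zero> then q ^ 5 + q ^ 4 - q ^ 3 else 0)"
  proof -
    have R: "int (card (ratios ?m1 ?m2 ?n1 ?n2)) =
        (if ?m1 = \<zero> \<and> ?m2 = \<zero> then (if ?n1 = \<zero> \<and> ?n2 = \<zero> then q else 0)
         else if minor_vanishes w b then 1 else 0)"
      by (simp add: card_ratios[OF cl] minor_vanishes_def q_def)
    have "minor_vanishes w b" if "?m1 = \<zero> \<and> ?m2 = \<zero>"
      using that cl by (simp add: minor_vanishes_def)
    moreover have "(if A then (q\<^sup>2 - 1) * q\<^sup>2 + (if B then q ^ 4 else 0) else 0)
        + (q\<^sup>2 - 1) * (q\<^sup>2 - q + q\<^sup>2 * (if A then (if B then q else 0) else if V then 1 else 0))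
      = (q\<^sup>2 - 1) * (q\<^sup>2 - q) + (if V then (q\<^sup>2 - 1) * q\<^sup>2 else 0)
        + (if A \<and> B then q ^ 5 + q ^ 4 - q ^ 3 else 0)" if "A \<Longrightarrow> V" for A B V
      using that by (cases A; cases B; cases V) (simp_all add: algebra_simps power_numeral_reduce)
    ultimately show ?thesis
      unfolding R conj_assoc[symmetric] by (simp only: conj_assoc)
  qed
  also have "(?m1 = \<zero> \<and> ?m2 = \<zero> \<and> ?n1 = \<zero> \<and> ?n2 = \<zero>) \<longleftrightarrow> (\<forall>e\<in>face_edges b. w e = \<zero>)"
    by (auto simp: face_edges_def)
  finally show ?thesis .
qed

end

section \<open>Vanishing minors\<close>

lemma separating_edge:
  assumes "S \<subseteq> faces" "S \<noteq> {}" "S \<noteq> faces"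
  obtains b e where "b \<in> S" "e \<in> face_edges b" "\<And>b'. b' \<in> S \<Longrightarrow> b' \<noteq> b \<Longrightarrow> e \<notin> face_edges b'"
proof -
  \<comment> \<open>Two faces share an edge unless they lie over the same pair of rows, so the dual
    graph is \<open>K(2,2,2)\<close> with the parts {4, 5}, {6, 7}, {8, 9}. As it is connected, some
    edge leads from \<open>S\<close> to a face outside, and no third face contains that
    edge.\<close>
  define adjacent where "adjacent b b' \<longleftrightarrow> (\<exists>e\<in>face_edges b. e \<in> face_edges b')" for b b'
  have adjacent: "adjacent b b'" if "b \<in> {4, 5}" "b' \<in> {6, 7, 8, 9}" for b b'
    using that unfolding adjacent_def by (elim insertE emptyE) (simp_all add: face_edges_def face_simps)
  have adjacent': "adjacent b b'" if "b \<in> {6, 7}" "b' \<in> {8, 9}" for b b'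
    using that unfolding adjacent_def by (elim insertE emptyE) (simp_all add: face_edges_def face_simps)
  have adjacent_sym: "adjacent b b' \<longleftrightarrow> adjacent b' b" for b b'
    by (auto simp: adjacent_def)
  have "\<exists>b\<in>S. \<exists>b'\<in>faces - S. adjacent b b'"
  proof (rule ccontr)
    assume "\<not> ?thesis"
    then have closed: "b' \<in> S \<longleftrightarrow> b \<in> S" if "b \<in> faces" "b' \<in> faces" "adjacent b b'" for b b'
      using that adjacent_sym assms(1) by blast
    have "8 \<in> S \<longleftrightarrow> b \<in> S" if "b \<in> {4, 5, 6, 7}" for b
      using that closed[of b 8] adjacent[of b 8] adjacent'[of b 8] by (auto simp: faces_def)
    moreover have "9 \<in> S \<longleftrightarrow> b \<in> S" if "b \<in> {4, 5, 6, 7}" for b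
      using that closed[of b 9] adjacent[of b 9] adjacent'[of b 9] by (auto simp: faces_def)
    ultimately have "b \<in> S \<longleftrightarrow> 8 \<in> S" if "b \<in> faces" for b
      using that unfolding faces_def by blast
    then show False using assms by blast
  qed
  then obtain b b' e where b: "b \<in> S" "b' \<in> faces - S" "e \<in> face_edges b" "e \<in> face_edges b'"
    by (auto simp: adjacent_def)
  have e: "e \<in> edges" using b assms(1) face_edges_subset by blast
  have "b'' \<in> {b, b'}" if "b'' \<in> faces" "e \<in> face_edges b''" for b''
    using that b assms(1) face_containing_edge[OF e] by (metis DiffE insert_iff subsetD)
  then have "e \<notin> face_edges b''" if "b'' \<in> S" "b'' \<noteq> b" for b''
    using that b(2) assms(1) by blast
  with b show thesis using that by blast
qed

text \<open>Overwriting coordinate \<open>i\<close> of a family satisfying \<open>R\<close> by an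
  arbitrary value is a bijection onto the families without the condition \<open>R\<close>: the
  overwritten value is recovered as the only one that restores \<open>R\<close>.\<close>

lemma card_PiE_determined_coordinate:
  assumes I: "i \<in> I"
    and Q: "\<And>w t. w \<in> PiE I T \<Longrightarrow> t \<in> T i \<Longrightarrow> Q (w(i := t)) \<longleftrightarrow> Q w"
    and R: "\<And>w. w \<in> PiE I T \<Longrightarrow> \<exists>!t. t \<in> T i \<and> R (w(i := t))"
  shows "card {w \<in> PiE I T. Q w \<and> R w} * card (T i) = card {w \<in> PiE I T. Q w}"
proof -
  have upd: "w(i := t) \<in> PiE I T" if "w \<in> PiE I T" "t \<in> T i" for w t
    using PiE_fun_upd[OF that(2,1)] I by (simp add: insert_absorb)
  have "bij_betw (\<lambda>(w, t). w(i := t)) ({w \<in> PiE I T. Q w \<and> R w} \<times> T i) {w \<in> PiE I T. Q w}"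
    unfolding bij_betw_def
  proof (intro conjI inj_onI equalityI subsetI)
    fix x y assume x: "x \<in> {w \<in> PiE I T. Q w \<and> R w} \<times> T i" and y: "y \<in> {w \<in> PiE I T. Q w \<and> R w} \<times> T i"
      and eq: "(\<lambda>(w, t). w(i := t)) x = (\<lambda>(w, t). w(i := t)) y"
    obtain w t w' t' where xy: "x = (w, t)" "y = (w', t')" by force
    have ww: "w(i := t) = w'(i := t')" using eq xy by simp
    then have t: "t = t'" by (metis fun_upd_same)
    have w': "w' = w(i := w' i)" using ww by (metis fun_upd_triv fun_upd_upd)
    \<comment> \<open>Since \<open>w\<close> and \<open>w'\<close> agree away from \<open>i\<close>,
      both values restore \<open>R\<close> in the same family.\<close>
    have "w i = w' i"
      using R[of w] x y xy w' PiE_mem[OF _ I] by (metis (no_types, lifting) fun_upd_triv mem_Collect_eq mem_Sigma_iff)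
    then show "x = y" using t w' xy by (metis fun_upd_triv)
  next
    fix v assume "v \<in> (\<lambda>(w, t). w(i := t)) ` ({w \<in> PiE I T. Q w \<and> R w} \<times> T i)"
    then obtain w t where wt: "w \<in> PiE I T" "Q w" "t \<in> T i" and v: "v = w(i := t)" by auto
    show "v \<in> {w \<in> PiE I T. Q w}"
      unfolding v using upd[OF wt(1,3)] Q[OF wt(1,3)] wt(2) by simp
  next
    fix v assume v: "v \<in> {w \<in> PiE I T. Q w}"
    then obtain t where t: "t \<in> T i" "R (v(i := t))" using R by blast
    have "v(i := t) \<in> {w \<in> PiE I T. Q w \<and> R w}"
      using upd[of v t] Q[of v t] v t by simp
    moreover have "v i \<in> T i" using PiE_mem[of v I T i] v I by simp
    moreover have "v = (\<lambda>(w, t). w(i := t)) (v(i := t), v i)" by simp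
    ultimately show "v \<in> (\<lambda>(w, t). w(i := t)) ` ({w \<in> PiE I T. Q w \<and> R w} \<times> T i)" by blast
  qed
  then show ?thesis
    using bij_betw_same_card by (fastforce simp: card_cartesian_product)
qed

section \<open>Expanding the product of face weights\<close>

definition full_faces :: "(nat \<times> nat) set \<Rightarrow> nat set" where
  "full_faces E = {b \<in> faces. face_edges b \<subseteq> E}"

definition generic_weight :: "int \<Rightarrow> int" where "generic_weight q = (q\<^sup>2 - 1) * (q\<^sup>2 - q)"
definition singular_weight :: "int \<Rightarrow> int" where "singular_weight q = (q\<^sup>2 - 1) * q\<^sup>2"

text \<open>The weight of a face not contained in the support \<open>E\<close> of \<open>w\<close>: its minor has at most one nonzero
  product, so whether it vanishes depends on \<open>E\<close> only.\<close>

definition support_weight :: "(nat \<times> nat) set \<Rightarrow> nat \<Rightarrow> int \<Rightarrow> int" where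
  "support_weight E b q = generic_weight q
     + (if \<not> {(plus_row b, left_col b), (minus_row b, right_col b)} \<subseteq> E \<and>
           \<not> {(plus_row b, right_col b), (minus_row b, left_col b)} \<subseteq> E then singular_weight q else 0)
     + (if face_edges b \<inter> E = {} then q ^ 5 + q ^ 4 - q ^ 3 else 0)"

text \<open>The index \<open>S\<close> is the set of full faces at which the summand for a vanishing
  minor is chosen, and \<open>(q - 1) ^ (card E - card S)\<close> is the number of \<open>w\<close>
  with support \<open>E\<close> whose minors vanish on \<open>S\<close>. \<open>S = faces\<close> is
  left out because there this number has another form.\<close>

definition regular_part :: "int \<Rightarrow> int" where
  "regular_part q = (\<Sum>E\<in>Pow edges. (\<Prod>b\<in>faces - full_faces E. support_weight E b q) *
     (\<Sum>S\<in>Pow (full_faces E) - {faces}. singular_weight q ^ card S *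
        generic_weight q ^ card (full_faces E - S) * (q - 1) ^ (card E - card S)))"

lemma full_faces_eq_faces_iff:
  assumes "E \<subseteq> edges" shows "faces \<subseteq> full_faces E \<longleftrightarrow> E = edges"
proof
  assume f: "faces \<subseteq> full_faces E"
  have "e \<in> E" if "e \<in> edges" for e
    using f plus_face(1,2)[OF that] by (auto simp: full_faces_def)
  then show "E = edges" using assms by blast
qed (use face_edges_subset in \<open>auto simp: full_faces_def\<close>)

context finite_field
begin

definition torus :: "(nat \<times> nat) set \<Rightarrow> (nat \<times> nat \<Rightarrow> 'a) set" where
  "torus E = (\<Pi>\<^sub>E e\<in>edges. if e \<in> E then carrier F - {\<zero>} else {\<zero>})"

lemma torus_mem:
  assumes "w \<in> torus E" "e \<in> edges"
  shows "w e \<in> carrier F" "w e = \<zero> \<longleftrightarrow> e \<notin> E"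
  using PiE_mem[OF assms(1)[unfolded torus_def] assms(2)] by (auto split: if_splits)

lemma torus_subset: "torus E \<subseteq> edges \<rightarrow>\<^sub>E carrier F"
  unfolding torus_def by (rule PiE_mono) simp

lemma finite_torus: "finite (torus E)"
  unfolding torus_def using finite_carrier by (intro finite_PiE) auto

lemma card_units: "card (carrier F - {\<zero>}) = card (carrier F) - 1"
  using finite_carrier by simp

lemma card_torus: "E \<subseteq> edges \<Longrightarrow> card (torus E) = (card (carrier F) - 1) ^ card E"
proof -
  assume E: "E \<subseteq> edges"
  have "card (torus E) = (\<Prod>e\<in>edges. if e \<in> E then card (carrier F) - 1 else 1)"
    unfolding torus_def by (simp add: card_PiE if_distrib[of card] card_units cong: if_cong)
  also have "\<dots> = (\<Prod>e\<in>E. card (carrier F) - 1)"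
    using E by (intro prod.mono_neutral_cong_right) auto
  finally show ?thesis by simp
qed

lemma sum_over_supports:
  "(\<Sum>w\<in>edges \<rightarrow>\<^sub>E carrier F. g w) = (\<Sum>E\<in>Pow edges. \<Sum>w\<in>torus E. (g w :: int))"
proof -
  have torus_support: "w \<in> torus E \<longleftrightarrow> w \<in> edges \<rightarrow>\<^sub>E carrier F \<and> {e \<in> edges. w e \<noteq> \<zero>} = E"
    if "E \<subseteq> edges" for w E
  proof
    assume w: "w \<in> torus E"
    have "{e \<in> edges. w e \<noteq> \<zero>} = E"
      using torus_mem(2)[OF w] that by blast
    then show "w \<in> edges \<rightarrow>\<^sub>E carrier F \<and> {e \<in> edges. w e \<noteq> \<zero>} = E"
      using torus_subset[of E] w by blast
  next
    assume "w \<in> edges \<rightarrow>\<^sub>E carrier F \<and> {e \<in> edges. w e \<noteq> \<zero>} = E"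
    then show "w \<in> torus E"
      by (auto simp: torus_def PiE_iff)
  qed
  have "(\<Sum>w\<in>edges \<rightarrow>\<^sub>E carrier F. g w)
      = (\<Sum>E\<in>Pow edges. \<Sum>w\<in>{w \<in> edges \<rightarrow>\<^sub>E carrier F. {e \<in> edges. w e \<noteq> \<zero>} = E}. g w)"
    by (rule sum.group[symmetric]) (use finite_carrier in \<open>auto intro!: finite_PiE\<close>)
  also have "\<dots> = (\<Sum>E\<in>Pow edges. \<Sum>w\<in>torus E. g w)"
    using torus_support by (intro sum.cong refl) auto
  finally show ?thesis .
qed

lemma unit_ratio:
  assumes "x \<in> carrier F - {\<zero>}" "y \<in> carrier F"
  obtains a where "a \<in> carrier F" "y = a \<otimes> x" "a = \<zero> \<longleftrightarrow> y = \<zero>"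
proof -
  obtain i where i: "i \<in> carrier F" "x \<otimes> i = \<one>" "i \<otimes> x = \<one>"
    using nonzero_inverse[of x] assms(1) by blast
  have "y = y \<otimes> i \<otimes> x" using i assms by (simp add: m_assoc)
  moreover have "y \<otimes> i = \<zero> \<longleftrightarrow> y = \<zero>" using i assms integral[of y i] by force
  ultimately show thesis using that[of "y \<otimes> i"] i assms by blast
qed

lemma ex1_unit_ratio:
  assumes "x \<in> carrier F - {\<zero>}" "y \<in> carrier F - {\<zero>}"
  shows "\<exists>!a. a \<in> carrier F - {\<zero>} \<and> a \<otimes> x = y"
proof -
  obtain a where "a \<in> carrier F" "y = a \<otimes> x" "a = \<zero> \<longleftrightarrow> y = \<zero>"
    using unit_ratio[OF assms(1)] assms(2) by blast
  with assms show ?thesis by (intro ex1I[of _ a]) (auto simp: m_rcancel)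
qed

text \<open>Each of the four entries occurs in just one of the two products of the minor and is
  multiplied there by a unit, so the condition is a linear equation for that entry with a unit
  solution.\<close>

lemma minor_vanishes_determines_entry:
  assumes w: "w \<in> torus E" and b: "b \<in> faces" and E: "face_edges b \<subseteq> E" and e: "e \<in> face_edges b"
  shows "\<exists>!t. t \<in> carrier F - {\<zero>} \<and> minor_vanishes (w(e := t)) b"
proof -
  let ?p = "plus_row b" and ?m = "minus_row b" and ?l = "left_col b" and ?r = "right_col b"
  have ne: "?p \<noteq> ?m" "?m \<noteq> ?p" "?l \<noteq> ?r" "?r \<noteq> ?l" using face_columns[OF b] by auto
  have unit: "w e \<in> carrier F - {\<zero>}" if "e \<in> face_edges b" for e
    using torus_mem[OF w, of e] face_edges_subset[OF b] E that by blast
  have u: "w (?p, ?l) \<in> carrier F - {\<zero>}" "w (?p, ?r) \<in> carrier F - {\<zero>}"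
      "w (?m, ?l) \<in> carrier F - {\<zero>}" "w (?m, ?r) \<in> carrier F - {\<zero>}"
    by (rule unit, simp add: face_edges_def)+
  have prod: "x \<otimes> y \<in> carrier F - {\<zero>}" if "x \<in> carrier F - {\<zero>}" "y \<in> carrier F - {\<zero>}" for x y
    using that integral by auto
  have *: "\<exists>!t. t \<in> carrier F - {\<zero>} \<and> P t"
    if "x \<in> carrier F - {\<zero>}" "y \<in> carrier F - {\<zero>}" "z \<in> carrier F - {\<zero>}"
      and "\<And>t. t \<in> carrier F - {\<zero>} \<Longrightarrow> P t \<longleftrightarrow> t \<otimes> x = y \<otimes> z" for x y z P
    using ex1_unit_ratio[OF that(1) prod[OF that(2,3)]] that(4) by metis
  from e consider "e = (?p, ?l)" | "e = (?p, ?r)" | "e = (?m, ?l)" | "e = (?m, ?r)"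
    by (auto simp: face_edges_def)
  then show ?thesis
  proof cases
    case 1
    show ?thesis by (rule *[OF u(4,2,3)]) (use ne 1 in \<open>simp add: minor_vanishes_def\<close>)
  next
    case 2
    show ?thesis by (rule *[OF u(3,1,4)]) (use ne 2 in \<open>auto simp: minor_vanishes_def\<close>)
  next
    case 3
    show ?thesis
    proof (rule *[OF u(2,1,4)])
      fix t assume "t \<in> carrier F - {\<zero>}"
      then have "t \<otimes> w (?p, ?r) = w (?p, ?r) \<otimes> t" using u(2) by (intro m_comm) simp_all
      then show "minor_vanishes (w(e := t)) b \<longleftrightarrow> t \<otimes> w (?p, ?r) = w (?p, ?l) \<otimes> w (?m, ?r)"
        using ne 3 by (auto simp: minor_vanishes_def)
    qed
  next
    case 4
    show ?thesis
    proof (rule *[OF u(1,2,3)])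
      fix t assume "t \<in> carrier F - {\<zero>}"
      then have "t \<otimes> w (?p, ?l) = w (?p, ?l) \<otimes> t" using u(1) by (intro m_comm) simp_all
      then show "minor_vanishes (w(e := t)) b \<longleftrightarrow> t \<otimes> w (?p, ?l) = w (?p, ?r) \<otimes> w (?m, ?l)"
        using ne 4 by (auto simp: minor_vanishes_def)
    qed
  qed
qed

lemma minor_vanishes_fun_upd:
  "e \<notin> face_edges b \<Longrightarrow> minor_vanishes (w(e := t)) b \<longleftrightarrow> minor_vanishes w b"
  by (auto simp: minor_vanishes_def face_edges_def)

text \<open>Each edge lies in exactly two faces, so a proper set of faces always has an edge in only
  one of its members; the condition of that face then fixes the entry at that edge.\<close>

lemma card_proper_minors_vanish:
  assumes E: "E \<subseteq> edges" and S: "S \<subseteq> full_faces E" "S \<noteq> faces"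
  shows "card {w \<in> torus E. \<forall>b\<in>S. minor_vanishes w b} * (card (carrier F) - 1) ^ card S
    = (card (carrier F) - 1) ^ card E"
  using S
proof (induction "card S" arbitrary: S)
  case 0
  then have "S \<subseteq> faces" by (auto simp: full_faces_def)
  then have "finite S" by (rule finite_subset) simp
  with 0 have "S = {}" by simp
  then show ?case using card_torus[OF E] by simp
next
  case (Suc n)
  have Sf: "S \<subseteq> faces" using Suc.prems by (auto simp: full_faces_def)
  have fin: "finite S" by (rule finite_subset[OF Sf]) simp
  have "S \<noteq> {}" using Suc.hyps(2) by auto
  then obtain b e where b: "b \<in> S" "e \<in> face_edges b"
    and free: "\<And>b'. b' \<in> S \<Longrightarrow> b' \<noteq> b \<Longrightarrow> e \<notin> face_edges b'"
    using separating_edge[OF Sf] Suc.prems(2) by metis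
  have bf: "b \<in> faces" "face_edges b \<subseteq> E" using b Suc.prems(1) by (auto simp: full_faces_def)
  have e: "e \<in> edges" "e \<in> E" using bf b(2) E by auto
  have n: "card (S - {b}) = n" using Suc.hyps(2) b fin by simp
  have IH: "card {w \<in> torus E. \<forall>b'\<in>S - {b}. minor_vanishes w b'} * (card (carrier F) - 1) ^ n
      = (card (carrier F) - 1) ^ card E"
    using Suc.hyps(1)[of "S - {b}"] n Suc.prems(1) bf(1) by auto
  have "card {w \<in> torus E. (\<forall>b'\<in>S - {b}. minor_vanishes w b') \<and> minor_vanishes w b} * card (carrier F - {\<zero>})
      = card {w \<in> torus E. \<forall>b'\<in>S - {b}. minor_vanishes w b'}"
    unfolding torus_def
  proof (rule card_PiE_determined_coordinate[where i = e and T = "\<lambda>e. if e \<in> E then carrier F - {\<zero>} else {\<zero>}", unfolded if_P[OF e(2)]])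
    show "(\<forall>b'\<in>S - {b}. minor_vanishes (w(e := t)) b') \<longleftrightarrow> (\<forall>b'\<in>S - {b}. minor_vanishes w b')" for w t
      using free minor_vanishes_fun_upd by (intro ball_cong refl) blast
    show "\<exists>!t. t \<in> carrier F - {\<zero>} \<and> minor_vanishes (w(e := t)) b"
      if "w \<in> (\<Pi>\<^sub>E e\<in>edges. if e \<in> E then carrier F - {\<zero>} else {\<zero>})" for w
      by (rule minor_vanishes_determines_entry[OF that[folded torus_def] bf b(2)])
  qed (use e in simp)
  moreover have "(\<forall>b'\<in>S - {b}. minor_vanishes w b') \<and> minor_vanishes w b \<longleftrightarrow> (\<forall>b'\<in>S. minor_vanishes w b')" for w
    using b(1) by blast
  ultimately have "card {w \<in> torus E. \<forall>b'\<in>S. minor_vanishes w b'} * (card (carrier F) - 1)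
      = card {w \<in> torus E. \<forall>b'\<in>S - {b}. minor_vanishes w b'}"
    by (simp add: card_units)
  then show ?case
    using IH unfolding Suc.hyps(2)[symmetric] power_Suc mult.assoc[symmetric] by simp
qed

lemma card_carrier_ge_2: "card (carrier F) \<ge> 2"
proof -
  have "card {\<zero>, \<one>} \<le> card (carrier F)"
    using finite_carrier by (intro card_mono) auto
  then show ?thesis by simp
qed

lemma card_proper_minors_vanish_int:
  assumes "E \<subseteq> edges" "S \<subseteq> full_faces E" "S \<noteq> faces"
  shows "int (card {w \<in> torus E. \<forall>b\<in>S. minor_vanishes w b}) = (int (card (carrier F)) - 1) ^ (card E - card S)"
proof -
  let ?N = "card {w \<in> torus E. \<forall>b\<in>S. minor_vanishes w b}" and ?u = "card (carrier F) - 1"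
  have eq: "?N * ?u ^ card S = ?u ^ card E" by (rule card_proper_minors_vanish[OF assms])
  have u: "?u \<ge> 1" using card_carrier_ge_2 by simp
  have "?N = ?u ^ (card E - card S)"
  \<comment> \<open>For \<open>q = 2\<close> all powers of \<open>q - 1\<close> are 1 and say
    nothing about the exponents. Otherwise \<open>eq\<close> forces \<open>card S\<close> to be at
    most \<open>card E\<close>, so the truncated subtraction is exact.\<close>
  proof (cases "?u = 1")
    case True
    then show ?thesis using eq by simp
  next
    case False
    then have u2: "?u > 1" using u by simp
    have "?N \<noteq> 0" using eq u2 by (metis less_numeral_extra(3) less_one mult_is_0 not_less power_not_zero zero_neq_one u)
    then have "?u ^ card S \<le> ?u ^ card E" unfolding eq[symmetric] by simp
    then have "card S \<le> card E" using u2 by (rule power_le_imp_le_exp[rotated])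
    then have eq': "?N * ?u ^ card S = ?u ^ (card E - card S) * ?u ^ card S"
      unfolding eq by (simp flip: power_add)
    have "?u ^ card S \<noteq> 0" using u2 by (intro power_not_zero) linarith
    from mult_right_cancel[OF this] eq' show ?thesis by (rule iffD1)
  qed
  then show ?thesis using u by (simp add: of_nat_diff)
qed

lemma card_fits_on_torus:
  assumes w: "w \<in> torus E" and b: "b \<in> faces"
  shows "int (card {d \<in> face_data. fits w b d}) =
    (if b \<in> full_faces E
     then generic_weight (int (card (carrier F))) + (if minor_vanishes w b then singular_weight (int (card (carrier F))) else 0)
     else support_weight E b (int (card (carrier F))))"
proof -
  let ?p = "plus_row b" and ?m = "minus_row b" and ?l = "left_col b" and ?r = "right_col b"
  have wF: "w \<in> edges \<rightarrow>\<^sub>E carrier F"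
    using w torus_subset by (rule subsetD[rotated])
  have edges: "e \<in> edges" if "e \<in> face_edges b" for e
    using face_edges_subset[OF b] that by blast
  have four: "(?p, ?l) \<in> face_edges b" "(?p, ?r) \<in> face_edges b" "(?m, ?l) \<in> face_edges b" "(?m, ?r) \<in> face_edges b"
    by (auto simp: face_edges_def)
  note fits = card_fits[OF wF b, folded generic_weight_def singular_weight_def]
  have zero: "(\<forall>e\<in>face_edges b. w e = \<zero>) \<longleftrightarrow> face_edges b \<inter> E = {}"
    using torus_mem(2)[OF w edges] by blast
  show ?thesis
  proof (cases "b \<in> full_faces E")
    case True
    then have nz: "\<not> (\<forall>e\<in>face_edges b. w e = \<zero>)" unfolding zero using four by (auto simp: full_faces_def)
    show ?thesis using fits True by (simp only: if_not_P[OF nz] if_True add_0_right)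
  next
    case False
    have c: "w e \<in> carrier F" "w e = \<zero> \<longleftrightarrow> e \<notin> E" if "e \<in> face_edges b" for e
      using torus_mem[OF w edges[OF that]] by auto
    have "\<not> face_edges b \<subseteq> E" using False b by (simp add: full_faces_def)
    then have not_all: "(?p, ?l) \<notin> E \<or> (?p, ?r) \<notin> E \<or> (?m, ?l) \<notin> E \<or> (?m, ?r) \<notin> E"
      by (auto simp: face_edges_def)
    have prod: "x \<otimes> y = \<zero> \<longleftrightarrow> x = \<zero> \<or> y = \<zero>" if "x \<in> carrier F" "y \<in> carrier F" for x y
      using that integral by auto
    have 1: "w (?p, ?l) \<otimes> w (?m, ?r) = \<zero> \<longleftrightarrow> \<not> {(?p, ?l), (?m, ?r)} \<subseteq> E"
      and 2: "w (?p, ?r) \<otimes> w (?m, ?l) = \<zero> \<longleftrightarrow> \<not> {(?p, ?r), (?m, ?l)} \<subseteq> E"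
      using prod[OF c(1)[OF four(1)] c(1)[OF four(4)]] prod[OF c(1)[OF four(2)] c(1)[OF four(3)]] c(2)[OF four(1)] c(2)[OF four(2)] c(2)[OF four(3)] c(2)[OF four(4)]
      by simp_all
    have "minor_vanishes w b \<longleftrightarrow> \<not> {(?p, ?l), (?m, ?r)} \<subseteq> E \<and> \<not> {(?p, ?r), (?m, ?l)} \<subseteq> E"
      unfolding minor_vanishes_def 1[symmetric] 2[symmetric] using not_all 1 2 by (metis empty_subsetI insert_subset)
    then show ?thesis using fits False zero by (simp add: support_weight_def)
  qed
qed

text \<open>On a fixed support only the full faces have weights that depend on \<open>w\<close>.
  Expanding their product over sets \<open>S\<close> and exchanging the sums turns the inner sum
  into the number of \<open>w\<close> whose minors vanish on \<open>S\<close>.\<close>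

lemma sum_prod_card_fits:
  fixes q :: int
  defines "q \<equiv> int (card (carrier F))"
  shows "int (\<Sum>w \<in> edges \<rightarrow>\<^sub>E carrier F. \<Prod>b\<in>faces. card {d \<in> face_data. fits w b d})
    = regular_part q + singular_weight q ^ 6 * int (card {w \<in> torus edges. \<forall>b\<in>faces. minor_vanishes w b})"
proof -
  let ?N = "\<lambda>E S. int (card {w \<in> torus E. \<forall>b\<in>S. minor_vanishes w b})"
  let ?K = "\<lambda>E. \<Prod>b\<in>faces - full_faces E. support_weight E b q"
  let ?t = "\<lambda>E S. singular_weight q ^ card S * generic_weight q ^ card (full_faces E - S) * ?N E S"
  have ff: "full_faces E \<subseteq> faces" for E by (auto simp: full_faces_def)
  have fin: "finite (full_faces E)" for E by (rule finite_subset[OF ff]) simp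
  have on_torus: "(\<Sum>w\<in>torus E. \<Prod>b\<in>faces. int (card {d \<in> face_data. fits w b d}))
      = ?K E * (\<Sum>S\<in>Pow (full_faces E). ?t E S)" if E: "E \<subseteq> edges" for E
  proof -
    have "(\<Prod>b\<in>faces. int (card {d \<in> face_data. fits w b d}))
      = ?K E * (\<Sum>S\<in>Pow (full_faces E). singular_weight q ^ card S * generic_weight q ^ card (full_faces E - S) *
          (if \<forall>b\<in>S. minor_vanishes w b then 1 else 0))" if w: "w \<in> torus E" for w
    proof -
      have "(\<Prod>b\<in>faces. int (card {d \<in> face_data. fits w b d}))
        = (\<Prod>b\<in>faces - full_faces E. int (card {d \<in> face_data. fits w b d})) * (\<Prod>b\<in>full_faces E. int (card {d \<in> face_data. fits w b d}))"
        by (rule prod.subset_diff[OF ff]) simp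
      also have "(\<Prod>b\<in>faces - full_faces E. int (card {d \<in> face_data. fits w b d})) = ?K E"
        by (rule prod.cong[OF refl]) (simp add: card_fits_on_torus[OF w] q_def)
      also have "(\<Prod>b\<in>full_faces E. int (card {d \<in> face_data. fits w b d}))
        = (\<Prod>b\<in>full_faces E. (if minor_vanishes w b then singular_weight q else 0) + generic_weight q)"
      proof (rule prod.cong[OF refl])
        fix b assume b: "b \<in> full_faces E"
        then have "b \<in> faces" using ff by (rule subsetD[rotated])
        from card_fits_on_torus[OF w this] b
        show "int (card {d \<in> face_data. fits w b d}) = (if minor_vanishes w b then singular_weight q else 0) + generic_weight q"
          by (simp only: if_True q_def add.commute)
      qed
      also have "\<dots> = (\<Sum>S\<in>Pow (full_faces E). (\<Prod>b\<in>S. if minor_vanishes w b then singular_weight q else 0) * (\<Prod>b\<in>full_faces E - S. generic_weight q))"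
        by (rule prod_add[OF fin])
      also have "\<dots> = (\<Sum>S\<in>Pow (full_faces E). singular_weight q ^ card S * generic_weight q ^ card (full_faces E - S) *
          (if \<forall>b\<in>S. minor_vanishes w b then 1 else 0))"
      proof (rule sum.cong[OF refl])
        fix S assume "S \<in> Pow (full_faces E)"
        then have finS: "finite S" using fin finite_subset by blast
        have "(\<Prod>b\<in>S. if minor_vanishes w b then singular_weight q else 0)
          = singular_weight q ^ card S * (if \<forall>b\<in>S. minor_vanishes w b then 1 else 0)"
        proof (cases "\<forall>b\<in>S. minor_vanishes w b")
          case False
          then have "(\<Prod>b\<in>S. if minor_vanishes w b then singular_weight q else 0) = 0"
            using finS by (auto intro!: prod_zero)
          then show ?thesis by (simp only: if_not_P[OF False] mult_zero_right)
        qed simp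
        then show "(\<Prod>b\<in>S. if minor_vanishes w b then singular_weight q else 0) * (\<Prod>b\<in>full_faces E - S. generic_weight q)
          = singular_weight q ^ card S * generic_weight q ^ card (full_faces E - S) * (if \<forall>b\<in>S. minor_vanishes w b then 1 else 0)"
          by simp
      qed
      finally show ?thesis .
    qed
    then have "(\<Sum>w\<in>torus E. \<Prod>b\<in>faces. int (card {d \<in> face_data. fits w b d}))
      = ?K E * (\<Sum>w\<in>torus E. \<Sum>S\<in>Pow (full_faces E). singular_weight q ^ card S * generic_weight q ^ card (full_faces E - S) *
          (if \<forall>b\<in>S. minor_vanishes w b then 1 else 0))"
      by (simp add: sum_distrib_left)
    also have "(\<Sum>w\<in>torus E. \<Sum>S\<in>Pow (full_faces E). singular_weight q ^ card S * generic_weight q ^ card (full_faces E - S) *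
          (if \<forall>b\<in>S. minor_vanishes w b then 1 else 0))
      = (\<Sum>S\<in>Pow (full_faces E). singular_weight q ^ card S * generic_weight q ^ card (full_faces E - S) *
          (\<Sum>w\<in>torus E. if \<forall>b\<in>S. minor_vanishes w b then 1 else 0))"
      by (subst sum.swap) (simp only: sum_distrib_left)
    also have "(\<lambda>S. \<Sum>w\<in>torus E. if \<forall>b\<in>S. minor_vanishes w b then 1 else 0) = ?N E"
      using finite_torus by (auto simp: sum.If_cases Int_def)
    finally show ?thesis .
  qed
  have "int (\<Sum>w \<in> edges \<rightarrow>\<^sub>E carrier F. \<Prod>b\<in>faces. card {d \<in> face_data. fits w b d})
      = (\<Sum>E\<in>Pow edges. \<Sum>w\<in>torus E. \<Prod>b\<in>faces. int (card {d \<in> face_data. fits w b d}))"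
    by (simp add: sum_over_supports)
  also have "\<dots> = (\<Sum>E\<in>Pow edges. ?K E * (\<Sum>S\<in>Pow (full_faces E). ?t E S))"
    using on_torus by (intro sum.cong refl) simp
  \<comment> \<open>The index \<open>S = faces\<close> occurs only for full support; there no
    generic factor is left and \<open>?K\<close> is an empty product.\<close>
  also have "\<dots> = (\<Sum>E\<in>Pow edges. ?K E * (\<Sum>S\<in>Pow (full_faces E) - {faces}. ?t E S)
      + (if E = edges then singular_weight q ^ 6 * ?N edges faces else 0))"
  proof (rule sum.cong[OF refl])
    fix E assume "E \<in> Pow edges"
    then have iff: "faces \<in> Pow (full_faces E) \<longleftrightarrow> E = edges" using full_faces_eq_faces_iff by simp
    show "?K E * (\<Sum>S\<in>Pow (full_faces E). ?t E S) = ?K E * (\<Sum>S\<in>Pow (full_faces E) - {faces}. ?t E S)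
      + (if E = edges then singular_weight q ^ 6 * ?N edges faces else 0)"
    proof (cases "E = edges")
      case True
      then have "full_faces E = faces" using iff ff by blast
      then show ?thesis
        using sum.remove[of "Pow faces" faces "?t E"] True by (simp add: card_faces)
    next
      case False
      then have "Pow (full_faces E) - {faces} = Pow (full_faces E)" using iff by blast
      then show ?thesis using False by simp
    qed
  qed
  also have "\<dots> = (\<Sum>E\<in>Pow edges. ?K E * (\<Sum>S\<in>Pow (full_faces E) - {faces}. ?t E S)) + singular_weight q ^ 6 * ?N edges faces"
    by (simp add: sum.distrib)
  also have "(\<Sum>E\<in>Pow edges. ?K E * (\<Sum>S\<in>Pow (full_faces E) - {faces}. ?t E S)) = regular_part q"
    unfolding regular_part_def
  proof (intro sum.cong refl arg_cong2[where f = "(*)"])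
    fix E S assume "E \<in> Pow edges" "S \<in> Pow (full_faces E) - {faces}"
    then show "?N E S = (q - 1) ^ (card E - card S)"
      using card_proper_minors_vanish_int[of E S] by (simp add: q_def)
  qed
  finally show ?thesis .
qed

section \<open>All six minors at once\<close>

lemma all_minors_vanish_iff:
  "(\<forall>b\<in>faces. minor_vanishes w b) \<longleftrightarrow>
     w (3, 10) \<otimes> w (2, 11) = w (3, 11) \<otimes> w (2, 10) \<and> w (3, 12) \<otimes> w (2, 13) = w (3, 13) \<otimes> w (2, 12) \<and>
     w (1, 10) \<otimes> w (3, 12) = w (1, 12) \<otimes> w (3, 10) \<and> w (1, 11) \<otimes> w (3, 13) = w (1, 13) \<otimes> w (3, 11) \<and>
     w (2, 10) \<otimes> w (1, 13) = w (2, 13) \<otimes> w (1, 10) \<and> w (2, 11) \<otimes> w (1, 12) = w (2, 12) \<otimes> w (1, 11)"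
  by (simp add: faces_def minor_vanishes_def face_simps)

definition square_roots_of_one :: "'a set" where
  "square_roots_of_one = {a \<in> carrier F. a \<otimes> a = \<one>}"

text \<open>If all minors vanish, rows 1 and 3 are multiples of row 2 up to a common sign \<open>s\<close> on half of the
  columns, and going around the six faces forces \<open>s \<otimes> s = \<one>\<close>.\<close>

definition rescaled_rows :: "(nat \<Rightarrow> 'a) \<times> 'a \<times> 'a \<times> 'a \<Rightarrow> nat \<times> nat \<Rightarrow> 'a" where
  "rescaled_rows = (\<lambda>(y, a, c, s). \<lambda>(i, j)\<in>edges.
     if i = 2 then y j
     else if i = 3 then (if j = 12 \<or> j = 13 then s \<otimes> a else a) \<otimes> y j
     else (if j = 11 \<or> j = 12 then s \<otimes> c else c) \<otimes> y j)"

lemma edges_simps [simp]: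
  "(1, 10) \<in> edges" "(1, 11) \<in> edges" "(1, 12) \<in> edges" "(1, 13) \<in> edges"
  "(2, 10) \<in> edges" "(2, 11) \<in> edges" "(2, 12) \<in> edges" "(2, 13) \<in> edges"
  "(3, 10) \<in> edges" "(3, 11) \<in> edges" "(3, 12) \<in> edges" "(3, 13) \<in> edges"
  "(Suc 0, 10) \<in> edges" "(Suc 0, 11) \<in> edges" "(Suc 0, 12) \<in> edges" "(Suc 0, 13) \<in> edges"
  by (simp_all add: edges_def rows_def cols_def)

text \<open>The exponent is 4 + 1 + 1: four entries of row 2, and the scalars \<open>a\<close> and
  \<open>c\<close> for rows 3 and 1.\<close>

lemma card_all_minors_vanish:
  "card {w \<in> torus edges. \<forall>b\<in>faces. minor_vanishes w b}
    = (card (carrier F) - 1) ^ 6 * card square_roots_of_one"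
proof -
  let ?U = "carrier F - {\<zero>}"
  let ?D = "(cols \<rightarrow>\<^sub>E ?U) \<times> ?U \<times> ?U \<times> square_roots_of_one"
  have prod: "x \<otimes> y \<in> ?U" if "x \<in> ?U" "y \<in> ?U" for x y
    using that integral[of x y] by auto
  have cancel: "x = y" if "x \<otimes> z = y \<otimes> z" "x \<in> carrier F" "y \<in> carrier F" "z \<in> ?U" for x y z
    using that m_rcancel[of z x y] by simp
  have root: "s \<in> ?U" "s \<otimes> s = \<one>" if "s \<in> square_roots_of_one" for s
    using that by (auto simp: square_roots_of_one_def)
  have inj: "inj_on rescaled_rows ?D"
  proof (rule inj_onI)
    fix d d' assume d: "d \<in> ?D" "d' \<in> ?D" and eq: "rescaled_rows d = rescaled_rows d'"
    obtain y a c s where d1: "d = (y, a, c, s)" "y \<in> cols \<rightarrow>\<^sub>E ?U" "a \<in> ?U" "c \<in> ?U" "s \<in> square_roots_of_one"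
      using d(1) by auto
    obtain y' a' c' s' where d2: "d' = (y', a', c', s')" "y' \<in> cols \<rightarrow>\<^sub>E ?U" "a' \<in> ?U" "c' \<in> ?U" "s' \<in> square_roots_of_one"
      using d(2) by auto
    note eq = fun_cong[OF eq[unfolded d1(1) d2(1) rescaled_rows_def prod.case]]
    have "y j = y' j" if "j \<in> cols" for j
      using eq[of "(2, j)"] that by (simp add: edges_def rows_def)
    then have y: "y = y'" using d1(2) d2(2) by (rule PiE_ext[rotated 2])
    have yU: "y' j \<in> ?U" if "j \<in> cols" for j using PiE_mem[OF d2(2) that] .
    have cols: "10 \<in> cols" "12 \<in> cols" by (simp_all add: cols_def)
    have a: "a = a'"
      by (rule cancel[of _ "y' 10"]) (use eq[of "(3, 10)"] y yU[OF cols(1)] d1(3) d2(3) in simp_all)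
    have c: "c = c'"
      by (rule cancel[of _ "y' 10"]) (use eq[of "(1, 10)"] y yU[OF cols(1)] d1(4) d2(4) in simp_all)
    have "s \<otimes> a' = s' \<otimes> a'"
      by (rule cancel[of _ "y' 12"]) (use eq[of "(3, 12)"] y a yU[OF cols(2)] d2(3) root(1)[OF d1(5)] root(1)[OF d2(5)] in simp_all)
    then have "s = s'"
      by (rule cancel) (use d2(3) root(1)[OF d1(5)] root(1)[OF d2(5)] in simp_all)
    then show "d = d'" using y a c by (simp add: d1(1) d2(1))
  qed
  have "rescaled_rows ` ?D = {w \<in> torus edges. \<forall>b\<in>faces. minor_vanishes w b}"
  proof (intro equalityI subsetI)
    fix w assume "w \<in> rescaled_rows ` ?D"
    then obtain y a c s where w: "w = rescaled_rows (y, a, c, s)" and y: "y \<in> cols \<rightarrow>\<^sub>E ?U"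
      and acs: "a \<in> ?U" "c \<in> ?U" "s \<in> square_roots_of_one" by auto
    note s = root[OF acs(3)]
    have yU: "y j \<in> ?U" if "j \<in> cols" for j using PiE_mem[OF y that] .
    have w_edge: "w (i, j) = (if i = 2 then y j
       else if i = 3 then (if j = 12 \<or> j = 13 then s \<otimes> a else a) \<otimes> y j
       else (if j = 11 \<or> j = 12 then s \<otimes> c else c) \<otimes> y j)" if "(i, j) \<in> edges" for i j
      using that unfolding w rescaled_rows_def by simp
    have "w (i, j) \<in> ?U" if "(i, j) \<in> edges" for i j
    proof -
      have j: "y j \<in> ?U" using yU edgesD(2)[OF that] .
      have "(if j = 12 \<or> j = 13 then s \<otimes> a else a) \<in> ?U" "(if j = 11 \<or> j = 12 then s \<otimes> c else c) \<in> ?U"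
        using prod[OF s(1) acs(1)] prod[OF s(1) acs(2)] acs(1,2) by presburger+
      from prod[OF this(1) j] prod[OF this(2) j] j show ?thesis unfolding w_edge[OF that] by presburger
    qed
    moreover have "w \<in> extensional edges"
      unfolding w rescaled_rows_def by simp
    ultimately have "w \<in> torus edges"
      by (auto simp: torus_def PiE_iff)
    moreover have "\<forall>b\<in>faces. minor_vanishes w b"
    proof -
      have cl: "y 10 \<in> carrier F" "y 11 \<in> carrier F" "y 12 \<in> carrier F" "y 13 \<in> carrier F"
        using yU[of 10] yU[of 11] yU[of 12] yU[of 13] by (auto simp: cols_def)
      have cl': "a \<in> carrier F" "c \<in> carrier F" "s \<in> carrier F" using acs s(1) by auto
      \<comment> \<open>At face 7 the factor \<open>s\<close> occurs twice in one product and not at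
        all in the other. At every other face it occurs equally often in both.\<close>
      have twist: "s \<otimes> c \<otimes> y 11 \<otimes> (s \<otimes> a \<otimes> y 13) = c \<otimes> y 13 \<otimes> (a \<otimes> y 11)"
      proof -
        have "s \<otimes> c \<otimes> y 11 \<otimes> (s \<otimes> a \<otimes> y 13) = (s \<otimes> s) \<otimes> (c \<otimes> y 13 \<otimes> (a \<otimes> y 11))"
          using cl cl' by (simp add: m_ac)
        then show ?thesis using s(2) cl cl' by simp
      qed
      show ?thesis
        unfolding all_minors_vanish_iff using twist cl cl' by (simp add: w_edge) (simp add: m_ac)
    qed
    ultimately show "w \<in> {w \<in> torus edges. \<forall>b\<in>faces. minor_vanishes w b}" by blast
  next
    fix w assume w: "w \<in> {w \<in> torus edges. \<forall>b\<in>faces. minor_vanishes w b}"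
    then have wt: "w \<in> torus edges" and minors: "\<forall>b\<in>faces. minor_vanishes w b" by auto
    have unit: "w e \<in> ?U" if "e \<in> edges" for e
      using torus_mem[OF wt that] that by simp
    have ratio: "\<exists>a\<in>?U. w (i, j) = a \<otimes> w (2, j)" if "(i, j) \<in> edges" "(2, j) \<in> edges" for i j
      using ex1_unit_ratio[OF unit[OF that(2)] unit[OF that(1)]] by metis
    obtain a0 a1 a2 a3 where a: "a0 \<in> ?U" "a1 \<in> ?U" "a2 \<in> ?U" "a3 \<in> ?U"
      "w (3, 10) = a0 \<otimes> w (2, 10)" "w (3, 11) = a1 \<otimes> w (2, 11)" "w (3, 12) = a2 \<otimes> w (2, 12)" "w (3, 13) = a3 \<otimes> w (2, 13)"
      using ratio[of 3 10] ratio[of 3 11] ratio[of 3 12] ratio[of 3 13] by (metis edges_simps)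
    obtain c0 c1 c2 c3 where c: "c0 \<in> ?U" "c1 \<in> ?U" "c2 \<in> ?U" "c3 \<in> ?U"
      "w (1, 10) = c0 \<otimes> w (2, 10)" "w (1, 11) = c1 \<otimes> w (2, 11)" "w (1, 12) = c2 \<otimes> w (2, 12)" "w (1, 13) = c3 \<otimes> w (2, 13)"
      using ratio[of 1 10] ratio[of 1 11] ratio[of 1 12] ratio[of 1 13] by (metis edges_simps)
    define y0 y1 y2 y3 where y_def: "y0 = w (2, 10)" "y1 = w (2, 11)" "y2 = w (2, 12)" "y3 = w (2, 13)"
    have y: "y0 \<in> ?U" "y1 \<in> ?U" "y2 \<in> ?U" "y3 \<in> ?U" unfolding y_def by (rule unit, simp)+
    note cl = a(1-4)[THEN DiffD1] c(1-4)[THEN DiffD1] y[THEN DiffD1]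
    have m: "a0 \<otimes> y0 \<otimes> y1 = a1 \<otimes> y1 \<otimes> y0" "a2 \<otimes> y2 \<otimes> y3 = a3 \<otimes> y3 \<otimes> y2"
      "c0 \<otimes> y0 \<otimes> (a2 \<otimes> y2) = c2 \<otimes> y2 \<otimes> (a0 \<otimes> y0)" "c1 \<otimes> y1 \<otimes> (a3 \<otimes> y3) = c3 \<otimes> y3 \<otimes> (a1 \<otimes> y1)"
      "y0 \<otimes> (c3 \<otimes> y3) = y3 \<otimes> (c0 \<otimes> y0)" "y1 \<otimes> (c2 \<otimes> y2) = y2 \<otimes> (c1 \<otimes> y1)"
      using minors unfolding all_minors_vanish_iff a(5-8) c(5-8) y_def by blast+
    \<comment> \<open>The faces 4 and 5, between rows 3 and 2, identify the ratios \<open>a\<close>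
      in pairs of columns; the faces 8 and 9, between rows 2 and 1, do so for \<open>c\<close>. The
      faces 6 and 7, between rows 1 and 3, then compare \<open>a\<close> with
      \<open>c\<close>.\<close>
    have a1: "a0 = a1" by (rule cancel[of _ "y0 \<otimes> y1"]) (use m(1) cl prod y in \<open>simp_all add: m_ac\<close>)
    have a3: "a2 = a3" by (rule cancel[of _ "y2 \<otimes> y3"]) (use m(2) cl prod y in \<open>simp_all add: m_ac\<close>)
    have c3: "c3 = c0" by (rule cancel[of _ "y0 \<otimes> y3"]) (use m(5) cl prod y in \<open>simp_all add: m_ac\<close>)
    have c1: "c2 = c1" by (rule cancel[of _ "y1 \<otimes> y2"]) (use m(6) cl prod y in \<open>simp_all add: m_ac\<close>)
    have e1: "c0 \<otimes> a2 = c2 \<otimes> a0" by (rule cancel[of _ "y0 \<otimes> y2"]) (use m(3) cl prod y in \<open>simp_all add: m_ac\<close>)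
    have e2: "c1 \<otimes> a3 = c3 \<otimes> a1" by (rule cancel[of _ "y1 \<otimes> y3"]) (use m(4) cl prod y in \<open>simp_all add: m_ac\<close>)
    obtain s where s: "s \<in> ?U" "a2 = s \<otimes> a0"
      using ex1_unit_ratio[OF a(1,3)] by metis
    have sF: "s \<in> carrier F" using s by simp
    have c2: "c2 = s \<otimes> c0"
      by (rule cancel[of _ a0]) (use e1 s(2) sF cl a in \<open>simp_all add: m_ac\<close>)
    \<comment> \<open>Face 6 says that \<open>c2 / c0\<close> equals \<open>a2 / a0\<close>, face 7
      that it equals the inverse \<open>a0 / a2\<close>. So \<open>s\<close> is its own
      inverse.\<close>
    have "(s \<otimes> s) \<otimes> (c0 \<otimes> a0) = \<one> \<otimes> (c0 \<otimes> a0)"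
      using e2 cl sF unfolding a1[symmetric] a3[symmetric] c3 c1[symmetric] c2 s(2) by (simp add: m_ac)
    then have "s \<otimes> s = \<one>"
      by (rule cancel) (use sF prod[OF c(1) a(1)] in simp_all)
    then have sq: "s \<in> square_roots_of_one" using sF by (simp add: square_roots_of_one_def)
    let ?y = "\<lambda>j\<in>cols. w (2, j)"
    have yP: "?y \<in> cols \<rightarrow>\<^sub>E ?U"
      using unit by (simp add: restrict_PiE_iff edges_def rows_def)
    note w_values = a(5) a(6)[folded a1] a(7)[unfolded s(2)] a(8)[folded a3, unfolded s(2)]
      c(5) c(6)[folded c1, unfolded c2] c(7)[unfolded c2] c(8)[unfolded c3]
    have "w e = rescaled_rows (?y, a0, c0, s) e" for e
    proof (cases "e \<in> edges")
      case True
      then show ?thesis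
        by (elim edge_cases) (simp_all add: rescaled_rows_def cols_def w_values del: One_nat_def)
    next
      case False
      then have "w e = undefined" using wt unfolding torus_def by (rule PiE_arb[rotated])
      then show ?thesis using False by (simp add: rescaled_rows_def)
    qed
    then have "w = rescaled_rows (?y, a0, c0, s)" by blast
    then show "w \<in> rescaled_rows ` ?D"
      by (rule image_eqI) (intro SigmaI yP a(1) c(1) sq)
  qed
  then have "card {w \<in> torus edges. \<forall>b\<in>faces. minor_vanishes w b} = card ?D"
    using card_image[OF inj] by simp
  also have "\<dots> = (card (carrier F) - 1) ^ 6 * card square_roots_of_one"
  proof -
    have "card cols = 4" by (simp add: cols_def)
    then show ?thesis
      by (simp add: card_cartesian_product card_PiE card_units eval_nat_numeral)
  qed
  finally show ?thesis .
qed

lemma class_number_formula: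
  fixes q :: int
  defines "q \<equiv> int (card (carrier F))"
  shows "int (class_number face_group) * q ^ 12
    = regular_part q + singular_weight q ^ 6 * (q - 1) ^ 6 * int (card square_roots_of_one)"
proof -
  have "int (card (carrier F) - 1) = q - 1"
    using card_carrier_ge_2 by (simp add: q_def of_nat_diff)
  then have "int (card {w \<in> torus edges. \<forall>b\<in>faces. minor_vanishes w b}) = (q - 1) ^ 6 * int (card square_roots_of_one)"
    by (simp add: card_all_minors_vanish)
  moreover have "int (class_number face_group) * q ^ 12
      = int (\<Sum>w \<in> edges \<rightarrow>\<^sub>E carrier F. \<Prod>b\<in>faces. card {d \<in> face_data. fits w b d})"
    unfolding class_number_face_group[symmetric] q_def by simp
  ultimately show ?thesis
    using sum_prod_card_fits unfolding q_def by simp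
qed

end

section \<open>Comparing odd primes with 2\<close>

declare atLeastAtMost_iff [simp]

section \<open>Prime fields with natural numbers as elements\<close>

definition nat_residue_ring :: "nat \<Rightarrow> nat ring" where
  "nat_residue_ring p = \<lparr>carrier = {0..<p}, monoid.mult = \<lambda>x y. x * y mod p, one = 1, zero = 0,
     add = \<lambda>x y. (x + y) mod p\<rparr>"

text \<open>The theorem speaks of rings on \<open>nat\<close>, so the field structure of
  \<open>residue_ring\<close> is carried over along the isomorphism \<open>nat\<close>.\<close>

lemma field_nat_residue_ring:
  assumes "prime p" shows "field (nat_residue_ring p)"
proof -
  interpret R: residues_prime p "residue_ring (int p)"
    by unfold_locales (use assms in auto)
  have p: "p > 1" using assms prime_gt_1_nat by blast
  have "nat \<in> ring_iso (residue_ring (int p)) (nat_residue_ring p)"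
  proof (rule ring_iso_memI)
    show "bij_betw nat (carrier (residue_ring (int p))) (carrier (nat_residue_ring p))"
      by (rule bij_betw_byWitness[where f' = int]) (auto simp: residue_ring_def nat_residue_ring_def)
  qed (auto simp: residue_ring_def nat_residue_ring_def nat_mult_distrib nat_add_distrib nat_mod_distrib)
  from R.ring_iso_imp_img_field[OF this] show ?thesis
    by (simp add: residue_ring_def nat_residue_ring_def)
qed

lemma card_square_roots_nat_residue_ring:
  fixes p :: nat
  assumes "prime p"
  shows "card {a \<in> {0..<p}. a * a mod p = 1} = (if p = 2 then 1 else 2)"
proof (cases "p = 2")
  case True
  have "{a \<in> {0..<2}. a * a mod 2 = (1::nat)} = {1}"
    by (auto simp: less_2_cases_iff)
  then show ?thesis using True by simp
next
  case False
  then have p: "p > 2" using assms prime_ge_2_nat[of p] by linarith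
  have "{a \<in> {0..<p}. a * a mod p = 1} = {1, p - 1}"
  proof (intro equalityI subsetI)
    fix a assume "a \<in> {a \<in> {0..<p}. a * a mod p = 1}"
    then have a: "a < p" "a * a mod p = 1" by auto
    have "a > 0" using a by (cases a) auto
    have "p dvd a * a - 1" using a(2) dvd_minus_mod[of p "a * a"] by simp
    also have "a * a - 1 = (a - 1) * (a + 1)" by (simp add: algebra_simps diff_mult_distrib)
    finally have "p dvd a - 1 \<or> p dvd a + 1" using assms prime_dvd_mult_iff by blast
    then show "a \<in> {1, p - 1}"
    proof
      assume "p dvd a - 1"
      then have "a - 1 = 0" using a(1) by (metis dvd_imp_le less_imp_diff_less not_gr_zero not_le)
      then show ?thesis using \<open>a > 0\<close> by simp
    next
      assume "p dvd a + 1"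
      then have "p \<le> a + 1" by (rule dvd_imp_le) simp
      then show ?thesis using a(1) by auto
    qed
  next
    fix a assume "a \<in> {1, p - 1}"
    moreover have "(p - 1) * (p - 1) = 1 + p * (p - 2)"
      using p by (cases p; cases "p - 1") (auto simp: algebra_simps)
    then have "(p - 1) * (p - 1) mod p = 1 mod p" by (simp only: mod_mult_self2)
    then have "(p - 1) * (p - 1) mod p = 1" using p by simp
    ultimately show "a \<in> {a \<in> {0..<p}. a * a mod p = 1}" using p by auto
  qed
  moreover have "(1::nat) \<noteq> p - 1" using p by simp
  ultimately show ?thesis using False by simp
qed

section \<open>Integer functions given by a polynomial\<close>

definition poly_fun :: "(int \<Rightarrow> int) \<Rightarrow> bool" where
  "poly_fun g \<longleftrightarrow> (\<exists>f :: complex poly. \<forall>x. of_int (g x) = poly f (of_int x))"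

lemma poly_fun_const: "poly_fun (\<lambda>_. c)"
  unfolding poly_fun_def by (rule exI[of _ "[:of_int c:]"]) simp

lemma poly_fun_ident: "poly_fun (\<lambda>x. x)"
  unfolding poly_fun_def by (rule exI[of _ "[:0, 1:]"]) simp

lemma poly_fun_add: "poly_fun g \<Longrightarrow> poly_fun h \<Longrightarrow> poly_fun (\<lambda>x. g x + h x)"
  unfolding poly_fun_def by (metis of_int_add poly_add)

lemma poly_fun_diff: "poly_fun g \<Longrightarrow> poly_fun h \<Longrightarrow> poly_fun (\<lambda>x. g x - h x)"
  unfolding poly_fun_def by (metis of_int_diff poly_diff)

lemma poly_fun_mult: "poly_fun g \<Longrightarrow> poly_fun h \<Longrightarrow> poly_fun (\<lambda>x. g x * h x)"
  unfolding poly_fun_def by (metis of_int_mult poly_mult)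

lemma poly_fun_power: "poly_fun g \<Longrightarrow> poly_fun (\<lambda>x. g x ^ n)"
  by (induction n) (auto intro: poly_fun_const poly_fun_mult)

lemma poly_fun_sum: "(\<And>i. i \<in> I \<Longrightarrow> poly_fun (g i)) \<Longrightarrow> poly_fun (\<lambda>x. \<Sum>i\<in>I. g i x)"
  by (induction I rule: infinite_finite_induct) (auto intro: poly_fun_const poly_fun_add)

lemma poly_fun_prod: "(\<And>i. i \<in> I \<Longrightarrow> poly_fun (g i)) \<Longrightarrow> poly_fun (\<lambda>x. \<Prod>i\<in>I. g i x)"
  by (induction I rule: infinite_finite_induct) (auto intro: poly_fun_const poly_fun_mult)

text \<open>With these closure rules \<open>regular_part\<close>, a sum over all supports, is seen
  to be polynomial without computing a coefficient.\<close>

lemmas poly_fun_intros = poly_fun_const poly_fun_ident poly_fun_add poly_fun_diff poly_fun_mult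
  poly_fun_power poly_fun_sum poly_fun_prod

text \<open>The condition \<open>c\<close> is independent of \<open>x\<close>. This is the case in
  \<open>support_weight\<close>, whose conditions involve only the support and the face.\<close>

lemma poly_fun_if: "poly_fun g \<Longrightarrow> poly_fun h \<Longrightarrow> poly_fun (\<lambda>x. if c then g x else h x)"
  by (cases c) simp_all

lemma poly_eq_of_odd_primes:
  fixes f g :: "complex poly"
  assumes "\<And>p. prime p \<Longrightarrow> p \<noteq> 2 \<Longrightarrow> poly f (of_nat p) = poly g (of_nat p)"
  shows "f = g"
proof (rule ccontr)
  assume "f \<noteq> g"
  then have "finite {x. poly (f - g) x = 0}" by (intro poly_roots_finite) simp
  moreover have "of_nat ` ({p. prime p} - {2}) \<subseteq> {x. poly (f - g) x = 0}"
    using assms by auto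
  ultimately have "finite (of_nat ` ({p. prime p} - {2}) :: complex set)"
    using finite_subset by blast
  then have "finite ({p::nat. prime p} - {2})"
    by (rule finite_imageD) (simp add: inj_on_def)
  then show False using primes_infinite by simp
qed

lemma poly_fun_singular_weight: "poly_fun singular_weight"
  unfolding singular_weight_def[abs_def] by (intro poly_fun_intros)

lemma poly_fun_regular_part: "poly_fun regular_part"
  unfolding regular_part_def[abs_def] support_weight_def generic_weight_def singular_weight_def
  by (intro poly_fun_intros poly_fun_if)

theorem theorem1p4:
  shows "\<exists>P. pattern_order 13 P \<and>
    \<not> (\<exists>f :: complex poly. \<forall>q :: nat. primepow q \<longrightarrow>
         (\<forall>F :: nat ring. field F \<and> order F = q \<longrightarrow>
            of_nat (class_number (pattern_group F 13 P)) = poly f (of_nat q)))"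
proof (intro exI[of _ face_order] conjI notI pattern_order_face_order)
  assume "\<exists>f :: complex poly. \<forall>q :: nat. primepow q \<longrightarrow>
         (\<forall>F :: nat ring. field F \<and> order F = q \<longrightarrow>
            of_nat (class_number (pattern_group F 13 face_order)) = poly f (of_nat q))"
  then obtain f :: "complex poly" where f: "\<And>F :: nat ring. primepow (order F) \<Longrightarrow> field F \<Longrightarrow>
      of_nat (class_number (pattern_group F 13 face_order)) = poly f (of_nat (order F))"
    by blast
  obtain g where g: "\<And>x. of_int (regular_part x) = poly g (of_int x :: complex)"
    using poly_fun_regular_part unfolding poly_fun_def by blast
  have "poly_fun (\<lambda>x. singular_weight x ^ 6 * (x - 1) ^ 6)"
    by (intro poly_fun_intros poly_fun_singular_weight)
  then obtain h where h: "\<And>x. of_int (singular_weight x ^ 6 * (x - 1) ^ 6) = poly h (of_int x :: complex)"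
    unfolding poly_fun_def by blast
  \<comment> \<open>Multiplying by \<open>[:0, 1:] ^ 12\<close>, the polynomial X^12, accounts for
    the factor \<open>q ^ 12\<close> in \<open>class_number_formula\<close>. The coefficient of
    \<open>h\<close> is the number of square roots of one modulo \<open>p\<close>.\<close>
  have key: "poly (f * [:0, 1:] ^ 12) (of_nat p) = poly (g + (if p = 2 then 1 else 2) * h) (of_nat p)"
    if p: "prime p" for p :: nat
  proof -
    let ?F = "nat_residue_ring p"
    interpret finite_field ?F
      using field_nat_residue_ring[OF p]
      by (simp add: finite_field_def finite_field_axioms_def) (simp add: nat_residue_ring_def)
    have card: "card (carrier ?F) = p" by (simp add: nat_residue_ring_def)
    have sq: "card square_roots_of_one = (if p = 2 then 1 else 2)"
      unfolding square_roots_of_one_def using card_square_roots_nat_residue_ring[OF p]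
      by (simp add: nat_residue_ring_def)
    have "of_nat (class_number face_group) = poly f (of_nat p)"
      using f[of ?F] field_axioms card p by (simp add: order_def)
    moreover have "of_nat (class_number face_group) * of_nat p ^ 12
        = (of_int (int (class_number face_group) * int p ^ 12) :: complex)"
      by simp
    moreover have "\<dots> = of_int (regular_part (int p)) +
        of_int (singular_weight (int p) ^ 6 * (int p - 1) ^ 6) * (if p = 2 then 1 else 2)"
      using class_number_formula unfolding card sq by simp
    ultimately show ?thesis
      unfolding g h by simp
  qed
  have "f * [:0, 1:] ^ 12 = g + 2 * h"
    by (rule poly_eq_of_odd_primes) (use key in force)
  \<comment> \<open>The identity from odd primes gives \<open>h\<close> the coefficient 2 at the
    point 2 as well, but the count there has coefficient 1. The difference is \<open>h\<close> at 2,
    which is \<open>singular_weight 2 ^ 6\<close>, that is 12^6.\<close>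
  with key[of 2] have "poly h 2 = 0" by simp
  then have "(of_int (singular_weight 2 ^ 6 * (2 - 1) ^ 6) :: complex) = 0"
    using h[of 2] by simp
  then show False by (simp add: singular_weight_def)
qed

end
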